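(* The set of finite TRSs that are confluent (confluent on every term) is $\Pi^0_2$-complete, and the set of finite TRSs that are ground confluent (confluent on every ground term) is $\Pi^0_2$-complete.
   Context: All TRSs are finite sets of rules over a finite signature; terms may contain variables, ground terms contain none. A TRS $R$ is confluent on a term $t$ if for all terms $t_1,t_2$ with $t_1 \leftarrow_R^* t\to_R^* t_2$ there is a term $d$ with $t_1\to_R^* d\leftarrow_R^* t_2$. TRSs and terms are encoded as natural numbers by a standard effective Gödel numbering, and properties are identified with the corresponding sets of codes. $\Sigma^0_n,\Pi^0_n$ are the classes of the arithmetical hierarchy; a set $B$ is $\mathcal P$-complete if $B\in\mathcal P$ and every $A\in\mathcal P$ is many-one reducible to $B$ via a total computable function. *)

theory Defs
  imports Main "HOL-Library.Nat_Bijection"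
begin

datatype recf =
    Zero
  | Succ
  | Proj nat
  | Comp recf "recf list"
  | Prim recf recf
  | Mn recf

inductive eval :: "recf \<Rightarrow> nat list \<Rightarrow> nat \<Rightarrow> bool" where
  eval_Zero: "eval Zero xs 0"
| eval_Succ: "eval Succ (x # xs) (Suc x)"
| eval_Proj: "i < length xs \<Longrightarrow> eval (Proj i) xs (xs ! i)"
| eval_Comp: "list_all2 (\<lambda>g y. eval g xs y) gs ys \<Longrightarrow> eval f ys z \<Longrightarrow> eval (Comp f gs) xs z"
| eval_Prim0: "eval f xs y \<Longrightarrow> eval (Prim f g) (0 # xs) y"
| eval_PrimS: "eval (Prim f g) (n # xs) y \<Longrightarrow> eval g (y # n # xs) z
     \<Longrightarrow> eval (Prim f g) (Suc n # xs) z"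
| eval_Mn: "eval f (n # xs) 0 \<Longrightarrow> (\<forall>m<n. \<exists>k. eval f (m # xs) (Suc k))
     \<Longrightarrow> eval (Mn f) xs n"
monos list.rel_mono

definition total_computable :: "(nat \<Rightarrow> nat) \<Rightarrow> bool" where
  "total_computable h \<longleftrightarrow> (\<exists>r. \<forall>n. eval r [n] (h n))"

definition decidable_set :: "nat set \<Rightarrow> bool" where
  "decidable_set A \<longleftrightarrow> total_computable (\<lambda>n. if n \<in> A then 1 else 0)"

fun Sigma0 :: "nat \<Rightarrow> nat set set" and Pi0 :: "nat \<Rightarrow> nat set set" where
  "Sigma0 0 = {A. decidable_set A}"
| "Pi0 0 = {A. decidable_set A}"
| "Sigma0 (Suc n) = {A. \<exists>B \<in> Pi0 n. \<forall>x. x \<in> A \<longleftrightarrow> (\<exists>y. prod_encode (x, y) \<in> B)}"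
| "Pi0 (Suc n) = {A. \<exists>B \<in> Sigma0 n. \<forall>x. x \<in> A \<longleftrightarrow> (\<forall>y. prod_encode (x, y) \<in> B)}"

definition many_one_reducible :: "nat set \<Rightarrow> nat set \<Rightarrow> bool" where
  "many_one_reducible A B \<longleftrightarrow> (\<exists>h. total_computable h \<and> (\<forall>x. x \<in> A \<longleftrightarrow> h x \<in> B))"

definition complete_for :: "nat set set \<Rightarrow> nat set \<Rightarrow> bool" where
  "complete_for P B \<longleftrightarrow> B \<in> P \<and> (\<forall>A \<in> P. many_one_reducible A B)"

datatype "term" = Var nat | Fun nat "term list"

fun subst :: "(nat \<Rightarrow> term) \<Rightarrow> term \<Rightarrow> term" where
  "subst \<sigma> (Var x) = \<sigma> x"
| "subst \<sigma> (Fun f ts) = Fun f (map (subst \<sigma>) ts)"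

fun vars :: "term \<Rightarrow> nat set" where
  "vars (Var x) = {x}"
| "vars (Fun f ts) = \<Union> (set (map vars ts))"

fun wf_term :: "(nat \<times> nat) set \<Rightarrow> term \<Rightarrow> bool" where
  "wf_term \<Sigma> (Var x) = True"
| "wf_term \<Sigma> (Fun f ts) = ((f, length ts) \<in> \<Sigma> \<and> (\<forall>t \<in> set ts. wf_term \<Sigma> t))"

definition ground :: "term \<Rightarrow> bool" where
  "ground t \<longleftrightarrow> vars t = {}"

definition is_trs :: "(nat \<times> nat) set \<Rightarrow> (term \<times> term) set \<Rightarrow> bool" where
  "is_trs \<Sigma> R \<longleftrightarrow> finite \<Sigma> \<and> finite R \<and>
     (\<forall>(l, r) \<in> R. wf_term \<Sigma> l \<and> wf_term \<Sigma> r \<and> (\<forall>x. l \<noteq> Var x) \<and> vars r \<subseteq> vars l)"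

inductive rstep :: "(term \<times> term) set \<Rightarrow> term \<Rightarrow> term \<Rightarrow> bool" for R where
  root: "(l, r) \<in> R \<Longrightarrow> rstep R (subst \<sigma> l) (subst \<sigma> r)"
| ctxt: "rstep R s t \<Longrightarrow> i < length ts
     \<Longrightarrow> rstep R (Fun f (ts[i := s])) (Fun f (ts[i := t]))"

definition rsteps :: "(term \<times> term) set \<Rightarrow> term \<Rightarrow> term \<Rightarrow> bool" where
  "rsteps R = (rstep R)\<^sup>*\<^sup>*"

definition confluent_on :: "(term \<times> term) set \<Rightarrow> term \<Rightarrow> bool" where
  "confluent_on R t \<longleftrightarrow> (\<forall>t1 t2. rsteps R t t1 \<and> rsteps R t t2 \<longrightarrow>
       (\<exists>d. rsteps R t1 d \<and> rsteps R t2 d))"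

definition confluent :: "(nat \<times> nat) set \<Rightarrow> (term \<times> term) set \<Rightarrow> bool" where
  "confluent \<Sigma> R \<longleftrightarrow> (\<forall>t. wf_term \<Sigma> t \<longrightarrow> confluent_on R t)"

definition ground_confluent :: "(nat \<times> nat) set \<Rightarrow> (term \<times> term) set \<Rightarrow> bool" where
  "ground_confluent \<Sigma> R \<longleftrightarrow> (\<forall>t. wf_term \<Sigma> t \<and> ground t \<longrightarrow> confluent_on R t)"

fun enc_term :: "term \<Rightarrow> nat" where
  "enc_term (Var x) = prod_encode (0, x)"
| "enc_term (Fun f ts) = prod_encode (1, prod_encode (f, list_encode (map enc_term ts)))"

definition enc_trs :: "(nat \<times> nat) list \<Rightarrow> (term \<times> term) list \<Rightarrow> nat" where
  "enc_trs sig rs = prod_encode (list_encode (map prod_encode sig),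
       list_encode (map (\<lambda>(l, r). prod_encode (enc_term l, enc_term r)) rs))"

definition trs_property_codes ::
    "((nat \<times> nat) set \<Rightarrow> (term \<times> term) set \<Rightarrow> bool) \<Rightarrow> nat set" where
  "trs_property_codes P = {enc_trs sig rs | sig rs. is_trs (set sig) (set rs) \<and> P (set sig) (set rs)}"

end

theory Submission
  imports Defs "HOL-Library.Confluence"
begin

text \<open>
  Membership in \<open>\<Pi>\<^sup>0\<^sub>2\<close>: well-formedness of a TRS and the relation \<open>\<rightarrow>\<^sup>*\<close> on codes of terms are given by a finite
  system of inference rules, so both are recursively enumerable with decidable derivations, and confluence
  says that for all pairs of derivations from a common term there is a pair of derivations to a common term.

  Hardness: a \<open>\<Pi>\<^sup>0\<^sub>2\<close> set consists of the \<open>x\<close> such that for every \<open>y\<close> the search for a \<open>z\<close> with a decidable property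
  succeeds. A TRS performs this search with an abstract machine that interprets recursive functions. Its only
  peaks come from a reversible scan of \<open>y\<close>: at one end of the scan the configuration may be rewritten to a
  constant \<open>mAccept\<close>, at the other end, which is reached only by meeting the \<open>0\<close> of a numeral, the scan may be
  irreversibly turned into the search, which ends in \<open>mAccept\<close> if it ends at all. Hence arguments that are not
  numerals, in particular variables, cause no divergence, and a numeral \<open>y\<close> does so if and only if its search
  fails. That root steps are the only source of divergence is due to the shape of the rules: they are
  left-linear, and control symbols occur exactly at the roots of both sides, so steps inside the
  arguments commute with root steps.
\<close>

section \<open>Total computable functions\<close>

text \<open>Confluence speaks about all terms, including configurations that no run from
  \<open>mStart\<close> ever reaches. These are harmless because a deterministic system is confluent
  even if it diverges or gets stuck: two configurations on one run are comparable. So the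
  interpreter may do anything on garbage, and only \<open>mStart\<close> and \<open>mScan\<close>
  need a genuine argument. With a one-way scan, \<open>mStart (Var 0)\<close> would be a bad peak,
  one branch being \<open>mAccept\<close> and the other a scan stuck at the variable; a reversible
  scan can walk back to \<open>mStart\<close> and accept. The quantifier over \<open>y\<close> thus
  becomes the quantifier over terms, and a failing search shows already on the ground term
  \<open>mStart (num y)\<close>, so one reduction serves both sets. The rules form a fixed
  interpreter instead of a translation of each function into its own rules: the instance then enters
  a single right-hand side, the reduction is computable from constants and one coded numeral, and
  the shape of the rules is checked once by simplification.\<close>

definition computable2 :: "(nat \<Rightarrow> nat \<Rightarrow> nat) \<Rightarrow> bool" where
  "computable2 f \<longleftrightarrow> (\<exists>r. \<forall>a b. eval r [a, b] (f a b))"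

lemma eval_Proj': "i < length xs \<Longrightarrow> xs ! i = y \<Longrightarrow> eval (Proj i) xs y"
  using eval_Proj by blast

lemma eval_Comp1: "eval g xs y \<Longrightarrow> eval f [y] z \<Longrightarrow> eval (Comp f [g]) xs z"
  by (rule eval_Comp[where ys = "[y]"]) auto

lemma eval_Comp2:
  "eval g xs y \<Longrightarrow> eval h xs y' \<Longrightarrow> eval f [y, y'] z \<Longrightarrow> eval (Comp f [g, h]) xs z"
  by (rule eval_Comp[where ys = "[y, y']"]) auto

lemma eval_Comp3:
  "eval g xs a \<Longrightarrow> eval h xs b \<Longrightarrow> eval k xs c \<Longrightarrow> eval f [a, b, c] z \<Longrightarrow> eval (Comp f [g, h, k]) xs z"
  by (rule eval_Comp[where ys = "[a, b, c]"]) auto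

lemma computable_comp:
  assumes "total_computable f" "total_computable g"
  shows "total_computable (\<lambda>x. f (g x))"
proof -
  obtain rf rg where "\<And>n. eval rf [n] (f n)" "\<And>n. eval rg [n] (g n)"
    using assms unfolding total_computable_def by blast
  then have "\<forall>n. eval (Comp rf [rg]) [n] (f (g n))"
    by (blast intro: eval_Comp1)
  then show ?thesis
    unfolding total_computable_def by blast
qed

lemma computable_comp2:
  assumes "computable2 f" "total_computable g" "total_computable h"
  shows "total_computable (\<lambda>x. f (g x) (h x))"
proof -
  obtain rf rg rh where "\<And>a b. eval rf [a, b] (f a b)" "\<And>n. eval rg [n] (g n)" "\<And>n. eval rh [n] (h n)"
    using assms unfolding total_computable_def computable2_def by blast
  then have "\<forall>n. eval (Comp rf [rg, rh]) [n] (f (g n) (h n))"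
    by (blast intro: eval_Comp2)
  then show ?thesis
    unfolding total_computable_def by blast
qed

lemma computable_id: "total_computable (\<lambda>x. x)"
  unfolding total_computable_def by (auto intro!: exI[of _ "Proj 0"] eval_Proj')

lemma computable_Suc_base: "total_computable Suc"
  unfolding total_computable_def by (auto intro!: exI[of _ Succ] eval_Succ)

lemmas computable_Suc = computable_comp[OF computable_Suc_base]

lemma computable_const: "total_computable (\<lambda>x. c)"
proof (induction c)
  case 0
  show ?case
    unfolding total_computable_def by (auto intro!: exI[of _ Zero] eval_Zero)
next
  case (Suc c)
  then show ?case
    by (rule computable_Suc)
qed

text \<open>Primitive recursion whose step ignores the counter, that is, a bounded loop. Addition,
  subtraction, codes of numerals and the run of the stack machine are instances.\<close>

lemma computable2_iter:
  assumes "total_computable f"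
  shows "computable2 (\<lambda>n x. (f ^^ n) x)"
proof -
  obtain r where r: "\<And>n. eval r [n] (f n)"
    using assms unfolding total_computable_def by blast
  have "eval (Prim (Proj 0) (Comp r [Proj 0])) [n, x] ((f ^^ n) x)" for n x
  proof (induction n)
    case 0
    show ?case by (auto intro!: eval_Prim0 eval_Proj')
  next
    case (Suc n)
    show ?case
      by (rule eval_PrimS[OF Suc.IH]) (auto intro!: eval_Comp1[OF eval_Proj' r])
  qed
  then show ?thesis
    unfolding computable2_def by blast
qed

lemma computable2_add: "computable2 (+)"
proof -
  have "(Suc ^^ n) x = n + x" for n x :: nat
    by (induction n) auto
  then show ?thesis
    using computable2_iter[OF computable_Suc_base] by simp
qed

lemma computable_pred: "total_computable (\<lambda>n. n - 1)"
proof -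
  have "eval (Prim Zero (Proj 1)) [n] (n - 1)" for n
  proof (induction n)
    case 0
    show ?case by (auto intro!: eval_Prim0 eval_Zero)
  next
    case (Suc n)
    show ?case
      by (rule eval_PrimS[OF Suc.IH]) (auto intro!: eval_Proj')
  qed
  then show ?thesis
    unfolding total_computable_def by blast
qed

lemma computable2_swap:
  assumes "computable2 f"
  shows "computable2 (\<lambda>a b. f b a)"
proof -
  obtain r where r: "\<And>a b. eval r [a, b] (f a b)"
    using assms unfolding computable2_def by blast
  have "eval (Comp r [Proj 1, Proj 0]) [a, b] (f b a)" for a b
    by (rule eval_Comp2[OF _ _ r]) (auto intro!: eval_Proj')
  then show ?thesis
    unfolding computable2_def by blast
qed

lemma computable2_diff: "computable2 (-)"
proof -
  have "((\<lambda>n. n - 1) ^^ n) x = x - n" for n x :: nat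
    by (induction n) auto
  then have "computable2 (\<lambda>n x. x - n)"
    using computable2_iter[OF computable_pred] by simp
  then show ?thesis
    by (rule computable2_swap)
qed

lemma computable_triangle: "total_computable triangle"
proof -
  obtain r where r: "\<And>a b. eval r [a, b] (a + b)"
    using computable2_add unfolding computable2_def by blast
  have "eval (Prim Zero (Comp r [Proj 0, Comp Succ [Proj 1]])) [n] (triangle n)" for n
  proof (induction n)
    case 0
    show ?case by (auto intro!: eval_Prim0 eval_Zero)
  next
    case (Suc n)
    have "eval (Comp r [Proj 0, Comp Succ [Proj 1]]) [triangle n, n] (triangle n + Suc n)"
      by (rule eval_Comp2[OF _ _ r]) (auto intro!: eval_Proj' eval_Comp1[OF eval_Proj'] eval_Succ)
    from eval_PrimS[OF Suc.IH this] show ?case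
      by simp
  qed
  then show ?thesis
    unfolding total_computable_def by blast
qed

lemma computable2_pair: "computable2 (\<lambda>a b. prod_encode (a, b))"
proof -
  obtain radd where radd: "\<And>a b. eval radd [a, b] (a + b)"
    using computable2_add unfolding computable2_def by blast
  obtain rt where rt: "\<And>n. eval rt [n] (triangle n)"
    using computable_triangle unfolding total_computable_def by blast
  have "eval (Comp radd [Comp rt [radd], Proj 0]) [a, b] (triangle (a + b) + a)" for a b
    by (rule eval_Comp2[OF eval_Comp1[OF radd rt] eval_Proj' radd]) auto
  then show ?thesis
    unfolding computable2_def prod_encode_def by auto
qed

lemmas computable_pair = computable_comp2[OF computable2_pair]
  and computable_diff = computable_comp2[OF computable2_diff]
  and computable_add = computable_comp2[OF computable2_add]

lemma computable_Least:
  assumes "computable2 f" and ex: "\<And>x. \<exists>n. f n x = 0"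
  shows "total_computable (\<lambda>x. LEAST n. f n x = 0)"
proof -
  obtain r where r: "\<And>a b. eval r [a, b] (f a b)"
    using assms unfolding computable2_def by blast
  have "eval (Mn r) [x] (LEAST n. f n x = 0)" for x
  proof (rule eval_Mn)
    show "eval r [LEAST n. f n x = 0, x] 0"
      using r[of "LEAST n. f n x = 0" x] LeastI_ex[OF ex[of x]] by simp
    show "\<forall>m<LEAST n. f n x = 0. \<exists>k. eval r [m, x] (Suc k)"
      using r not_less_Least by (metis not0_implies_Suc)
  qed
  then show ?thesis
    unfolding total_computable_def by blast
qed

section \<open>Decoding of pairs is computable\<close>

definition pfst :: "nat \<Rightarrow> nat" where "pfst n = fst (prod_decode n)"
definition psnd :: "nat \<Rightarrow> nat" where "psnd n = snd (prod_decode n)"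

lemma pfst_pair [simp]: "pfst (prod_encode (a, b)) = a"
  and psnd_pair [simp]: "psnd (prod_encode (a, b)) = b"
  and pair_pfst_psnd [simp]: "prod_encode (pfst n, psnd n) = n"
  by (simp_all add: pfst_def psnd_def)

lemma triangle_mono: "m \<le> n \<Longrightarrow> triangle m \<le> triangle n"
  by (induction n) (auto simp: le_Suc_eq)

text \<open>With \<open>prod_encode (a, b) = triangle (a + b) + a\<close>, the diagonal
  \<open>a + b\<close> is the least \<open>s\<close> with \<open>n < triangle (Suc s)\<close>. The
  inequality is written as a vanishing truncated difference to fit
  \<open>computable_Least\<close>.\<close>

lemma diagonal_eq_Least:
  "pfst n + psnd n = (LEAST s. Suc n - triangle (Suc s) = 0)"
proof -
  obtain a b where n: "n = prod_encode (a, b)"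
    by (metis pair_pfst_psnd)
  have "(LEAST s. Suc n - triangle (Suc s) = 0) = a + b"
  proof (rule Least_equality)
    show "Suc n - triangle (Suc (a + b)) = 0"
      by (simp add: n prod_encode_def)
    fix s assume s: "Suc n - triangle (Suc s) = 0"
    show "a + b \<le> s"
    proof (rule ccontr)
      assume "\<not> a + b \<le> s"
      then have "triangle (Suc s) \<le> triangle (a + b)"
        by (intro triangle_mono) simp
      with s show False
        by (simp add: n prod_encode_def)
    qed
  qed
  then show ?thesis
    by (simp add: n)
qed

lemma computable_diagonal: "total_computable (\<lambda>n. pfst n + psnd n)"
proof -
  obtain rd where rd: "\<And>a b. eval rd [a, b] (a - b)"
    using computable2_diff unfolding computable2_def by blast
  obtain rt where rt: "\<And>n. eval rt [n] (triangle n)"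
    using computable_triangle unfolding total_computable_def by blast
  have "eval (Comp rd [Comp Succ [Proj 1], Comp rt [Comp Succ [Proj 0]]]) [s, n] (Suc n - triangle (Suc s))"
    for s n
    by (rule eval_Comp2[OF eval_Comp1[OF eval_Proj' eval_Succ]
            eval_Comp1[OF eval_Comp1[OF eval_Proj' eval_Succ] rt] rd]) simp_all
  then have c: "computable2 (\<lambda>s n. Suc n - triangle (Suc s))"
    unfolding computable2_def by blast
  have "\<exists>s. Suc n - triangle (Suc s) = 0" for n
    by (rule exI[of _ "n"]) (induction n; simp)
  from computable_Least[OF c this] show ?thesis
    unfolding diagonal_eq_Least .
qed

lemma computable_pfst_base: "total_computable pfst"
proof -
  have "pfst = (\<lambda>n. n - triangle (pfst n + psnd n))"
  proof
    fix n
    have "n = triangle (pfst n + psnd n) + pfst n"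
      using pair_pfst_psnd[of n] unfolding prod_encode_def by simp
    then show "pfst n = n - triangle (pfst n + psnd n)"
      by simp
  qed
  then show ?thesis
    using computable_diff[OF computable_id computable_comp[OF computable_triangle computable_diagonal]]
    by simp
qed

lemma computable_psnd_base: "total_computable psnd"
  using computable_diff[OF computable_diagonal computable_pfst_base] by simp

lemmas computable_pfst = computable_comp[OF computable_pfst_base]
  and computable_psnd = computable_comp[OF computable_psnd_base]
  and computable_minus_1 = computable_comp[OF computable_pred]

lemma computable_if0:
  assumes "total_computable c" "total_computable f" "total_computable g"
  shows "total_computable (\<lambda>x. if c x = 0 then f x else g x)"
proof -
  \<comment> \<open>In the base case the arguments are \<open>a, b\<close>, so \<open>Proj 0\<close>
    picks \<open>a\<close>; in the successor case the previous value and the counter come first, so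
    \<open>Proj 3\<close> picks \<open>b\<close>.\<close>
  have P: "eval (Prim (Proj 0) (Proj 3)) [n, a, b] (if n = 0 then a else b)" for n a b
  proof (induction n)
    case 0
    show ?case by (auto intro!: eval_Prim0 eval_Proj')
  next
    case (Suc n)
    show ?case
      by (rule eval_PrimS[OF Suc.IH]) (auto intro!: eval_Proj')
  qed
  obtain rc rf rg where "\<And>n. eval rc [n] (c n)" "\<And>n. eval rf [n] (f n)" "\<And>n. eval rg [n] (g n)"
    using assms unfolding total_computable_def by blast
  then have "\<forall>n. eval (Comp (Prim (Proj 0) (Proj 3)) [rc, rf, rg]) [n] (if c n = 0 then f n else g n)"
    by (blast intro: eval_Comp3 P)
  then show ?thesis
    unfolding total_computable_def by blast
qed

lemma computable_if_eq:
  assumes "total_computable a" "total_computable b" "total_computable f" "total_computable g"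
  shows "total_computable (\<lambda>x. if a x = b x then f x else g x)"
proof -
  \<comment> \<open>With truncated subtraction, the sum of both differences is the distance of
    \<open>a x\<close> and \<open>b x\<close>.\<close>
  have "total_computable (\<lambda>x. if (a x - b x) + (b x - a x) = 0 then f x else g x)"
    by (intro computable_if0 computable_add computable_diff assms)
  moreover have "(a x - b x) + (b x - a x) = 0 \<longleftrightarrow> a x = b x" for x
    by auto
  ultimately show ?thesis
    by simp
qed

lemma computable_iter:
  assumes "total_computable f" "total_computable n" "total_computable a"
  shows "total_computable (\<lambda>x. (f ^^ n x) (a x))"
  using computable_comp2[OF computable2_iter[OF assms(1)] assms(2,3)] .

lemma decidable_conj:
  assumes "total_computable (\<lambda>x. if P x then 1 else 0)" "total_computable (\<lambda>x. if Q x then 1 else 0)"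
  shows "total_computable (\<lambda>x. if P x \<and> Q x then 1 else 0)"
proof -
  have "(\<lambda>x. if P x \<and> Q x then 1 else 0) =
      (\<lambda>x. if (if P x then 1 else 0) = (0::nat) then 0 else (if Q x then 1 else 0 :: nat))"
    by auto
  then show ?thesis
    using computable_if0[OF assms(1) computable_const assms(2)] by simp
qed

lemma decidable_not:
  assumes "total_computable (\<lambda>x. if P x then 1 else 0)"
  shows "total_computable (\<lambda>x. if \<not> P x then 1 else 0)"
proof -
  have "(\<lambda>x. if \<not> P x then 1 else 0) = (\<lambda>x. if (if P x then 1 else 0) = (0::nat) then 1 else 0 :: nat)"
    by auto
  then show ?thesis
    using computable_if0[OF assms computable_const computable_const] by simp
qed

lemma decidable_eq:
  "total_computable f \<Longrightarrow> total_computable g \<Longrightarrow> total_computable (\<lambda>x. if f x = g x then 1 else 0)"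
  by (intro computable_if_eq computable_const)

text \<open>Both halves of the proof use this normal form: hardness takes its search predicate from
  \<open>C\<close>, membership builds such a \<open>C\<close> from checks of derivations.\<close>

lemma Pi0_2_iff:
  "A \<in> Pi0 2 \<longleftrightarrow> (\<exists>C. decidable_set C \<and>
     (\<forall>x. x \<in> A \<longleftrightarrow> (\<forall>y. \<exists>z. prod_encode (prod_encode (x, y), z) \<in> C)))"
  (is "_ \<longleftrightarrow> ?R")
proof
  assume "A \<in> Pi0 2"
  then show ?R
    by (auto simp: numeral_2_eq_2)
next
  assume ?R
  then obtain C where C: "decidable_set C"
      "\<And>x. x \<in> A \<longleftrightarrow> (\<forall>y. \<exists>z. prod_encode (prod_encode (x, y), z) \<in> C)"
    by blast
  define B where "B = {w. \<exists>z. prod_encode (w, z) \<in> C}"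
  have "B \<in> Sigma0 (Suc 0)"
    using C(1) by (auto simp: B_def)
  moreover have "\<forall>x. x \<in> A \<longleftrightarrow> (\<forall>y. prod_encode (x, y) \<in> B)"
    using C(2) by (simp add: B_def)
  ultimately show "A \<in> Pi0 2"
    by (auto simp: numeral_2_eq_2 simp del: Sigma0.simps)
qed

section \<open>Confluence from root confluence\<close>

definition root_step :: "(term \<times> term) set \<Rightarrow> term \<Rightarrow> term \<Rightarrow> bool" where
  "root_step R s t \<longleftrightarrow> (\<exists>l r \<sigma>. (l, r) \<in> R \<and> s = subst \<sigma> l \<and> t = subst \<sigma> r)"

definition inner_step :: "(term \<times> term) set \<Rightarrow> term \<Rightarrow> term \<Rightarrow> bool" where
  "inner_step R s t \<longleftrightarrow>
     (\<exists>f ts i u. s = Fun f ts \<and> i < length ts \<and> rstep R (ts ! i) u \<and> t = Fun f (ts[i := u]))"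

lemma rstep_iff_root_or_inner: "rstep R s t \<longleftrightarrow> root_step R s t \<or> inner_step R s t"
proof
  assume "rstep R s t"
  then show "root_step R s t \<or> inner_step R s t"
  proof cases
    case (root l r \<sigma>)
    then show ?thesis unfolding root_step_def by blast
  next
    case (ctxt s' t' i ts f)
    then have "s = Fun f (ts[i := s']) \<and> i < length (ts[i := s']) \<and> rstep R (ts[i := s'] ! i) t' \<and>
        t = Fun f ((ts[i := s'])[i := t'])"
      by simp
    then show ?thesis unfolding inner_step_def by blast
  qed
next
  assume "root_step R s t \<or> inner_step R s t"
  then show "rstep R s t"
  proof
    assume "root_step R s t"
    then show ?thesis
      unfolding root_step_def by (auto intro: rstep.root)
  next
    assume "inner_step R s t"
    then obtain f ts i u where "s = Fun f ts" "i < length ts" "rstep R (ts ! i) u" "t = Fun f (ts[i := u])"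
      unfolding inner_step_def by blast
    then show ?thesis
      using rstep.ctxt[of R "ts ! i" u i ts f] by simp
  qed
qed

lemma rsteps_refl [simp]: "rsteps R t t"
  by (simp add: rsteps_def)

lemma rsteps_trans: "rsteps R s t \<Longrightarrow> rsteps R t u \<Longrightarrow> rsteps R s u"
  by (simp add: rsteps_def)

lemma root_steps_imp_rsteps: "(root_step R)\<^sup>*\<^sup>* s t \<Longrightarrow> rsteps R s t"
  unfolding rsteps_def by (rule rtranclp_mono[THEN predicate2D]) (auto simp: rstep_iff_root_or_inner)

lemma inner_steps_imp_rsteps: "(inner_step R)\<^sup>*\<^sup>* s t \<Longrightarrow> rsteps R s t"
  unfolding rsteps_def by (rule rtranclp_mono[THEN predicate2D]) (auto simp: rstep_iff_root_or_inner)

lemma inner_steps_Fun_nth: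
  assumes "rsteps R (ts ! i) u" "i < length ts"
  shows "(inner_step R)\<^sup>*\<^sup>* (Fun f ts) (Fun f (ts[i := u]))"
  using assms(1) unfolding rsteps_def
proof (induction rule: rtranclp_induct)
  case base
  then show ?case using assms(2) by simp
next
  case (step u v)
  have "inner_step R (Fun f (ts[i := u])) (Fun f (ts[i := v]))"
    unfolding inner_step_def using assms(2) step(2)
    by (intro exI[of _ f] exI[of _ "ts[i := u]"] exI[of _ i] exI[of _ v]) simp
  with step.IH show ?case by simp
qed

text \<open>The arguments are rewritten from left to right; \<open>ss\<close> holds those already
  treated and has to vary in the induction.\<close>

lemma inner_steps_Fun_append:
  assumes "list_all2 (rsteps R) ts us"
  shows "(inner_step R)\<^sup>*\<^sup>* (Fun f (ss @ ts)) (Fun f (ss @ us))"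
  using assms
proof (induction ts us arbitrary: ss rule: list_all2_induct)
  case Nil
  then show ?case by simp
next
  case (Cons t ts u us)
  have "(inner_step R)\<^sup>*\<^sup>* (Fun f (ss @ t # ts)) (Fun f (ss @ u # ts))"
    using inner_steps_Fun_nth[of R "ss @ t # ts" "length ss" u f] Cons by simp
  with Cons.IH[of "ss @ [u]"] show ?case by simp
qed

lemma inner_steps_Fun_iff:
  "(inner_step R)\<^sup>*\<^sup>* (Fun f ts) u \<longleftrightarrow> (\<exists>us. u = Fun f us \<and> list_all2 (rsteps R) ts us)"
proof
  assume "(inner_step R)\<^sup>*\<^sup>* (Fun f ts) u"
  then show "\<exists>us. u = Fun f us \<and> list_all2 (rsteps R) ts us"
  proof (induction rule: rtranclp_induct)
    case base
    then show ?case by (auto intro: list_all2_refl)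
  next
    case (step u v)
    then obtain us i w where us: "u = Fun f us" "list_all2 (rsteps R) ts us" "i < length us"
      "rstep R (us ! i) w" "v = Fun f (us[i := w])"
      unfolding inner_step_def by auto
    have "list_all2 (rsteps R) ts (us[i := w])"
      using us unfolding list_all2_conv_all_nth
      by (auto simp: nth_list_update rsteps_def intro: rtranclp.rtrancl_into_rtrancl)
    with us show ?case by blast
  qed
next
  assume "\<exists>us. u = Fun f us \<and> list_all2 (rsteps R) ts us"
  then show "(inner_step R)\<^sup>*\<^sup>* (Fun f ts) u"
    using inner_steps_Fun_append[of R ts _ f "[]"] by auto
qed

lemma rsteps_Fun: "list_all2 (rsteps R) ts us \<Longrightarrow> rsteps R (Fun f ts) (Fun f us)"
  by (rule inner_steps_imp_rsteps) (simp add: inner_steps_Fun_iff)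

lemma rsteps_subst:
  assumes "\<And>x. x \<in> vars t \<Longrightarrow> rsteps R (\<sigma> x) (\<tau> x)"
  shows "rsteps R (subst \<sigma> t) (subst \<tau> t)"
  using assms
proof (induction t)
  case (Fun f ts)
  show ?case
    by (auto simp: list_all2_conv_all_nth intro!: rsteps_Fun Fun.IH Fun.prems bexI[OF _ nth_mem])
qed simp

lemma subst_cong: "(\<And>x. x \<in> vars t \<Longrightarrow> \<sigma> x = \<tau> x) \<Longrightarrow> subst \<sigma> t = subst \<tau> t"
  by (induction t) auto

text \<open>Repetitions are kept, so \<open>distinct (vars_list t)\<close> says that
  \<open>t\<close> is linear.\<close>

fun vars_list :: "term \<Rightarrow> nat list" where
  "vars_list (Var x) = [x]"
| "vars_list (Fun f ts) = concat (map vars_list ts)"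

lemma set_vars_list: "set (vars_list t) = vars t"
  by (induction t) auto

fun funs :: "term \<Rightarrow> nat set" where
  "funs (Var x) = {}"
| "funs (Fun f ts) = insert f (\<Union> (set (map funs ts)))"

lemma distinct_concat_nth_disjoint:
  assumes "distinct (concat (map vars_list ts))" "i < length ts" "j < length ts" "i \<noteq> j"
  shows "set (vars_list (ts ! i)) \<inter> set (vars_list (ts ! j)) = {}"
  using assms
proof (induction ts arbitrary: i j)
  case (Cons t ts)
  have *: "set (vars_list t) \<inter> set (vars_list (ts ! k)) = {}" if "k < length ts" for k
    using Cons.prems(1) nth_mem[OF that] by auto
  show ?case
  proof (cases i)
    case 0
    with Cons.prems obtain j' where "j = Suc j'" "j' < length ts" by (cases j) auto
    with 0 * show ?thesis by simp
  next
    case (Suc i')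
    show ?thesis
    proof (cases j)
      case 0
      with Suc Cons.prems *[of i'] show ?thesis by (simp add: Int_commute)
    next
      case (Suc j')
      with \<open>i = Suc i'\<close> Cons.prems show ?thesis
        using Cons.IH[of i' j'] by simp
    qed
  qed
qed simp

lemma list_all2_rsteps_join:
  assumes "\<forall>t \<in> set ts. confluent_on R t" "list_all2 (rsteps R) ts us" "list_all2 (rsteps R) ts vs"
  shows "\<exists>ds. list_all2 (rsteps R) us ds \<and> list_all2 (rsteps R) vs ds"
proof -
  have len: "length us = length ts" "length vs = length ts"
    using assms(2,3) by (auto dest: list_all2_lengthD)
  have "\<exists>d. rsteps R (us ! i) d \<and> rsteps R (vs ! i) d" if "i < length ts" for i
    using assms that unfolding confluent_on_def list_all2_conv_all_nth by (meson nth_mem)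
  then obtain d where "\<And>i. i < length ts \<Longrightarrow> rsteps R (us ! i) (d i) \<and> rsteps R (vs ! i) (d i)"
    by metis
  then show ?thesis
    by (intro exI[of _ "map d [0..<length ts]"]) (auto simp: list_all2_conv_all_nth len)
qed

text \<open>\<open>F\<close> is the set of control symbols. Patterns below a root contain none, so
  no rule overlaps another one below its root; right-hand sides keep one at the root, so a root step
  never exposes an argument, and reducing the arguments of a constructor never turns it into a
  redex.\<close>

locale flat_trs =
  fixes R :: "(term \<times> term) set" and F :: "nat set"
  assumes rule_shape: "(l, r) \<in> R \<Longrightarrow> \<exists>f ps g qs. l = Fun f ps \<and> r = Fun g qs \<and> f \<in> F \<and> g \<in> F \<and>
      (\<forall>p \<in> set ps. funs p \<inter> F = {}) \<and> (\<forall>q \<in> set qs. funs q \<inter> F = {})"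
    and left_linear: "(l, r) \<in> R \<Longrightarrow> distinct (vars_list l)"
    and vars_rule: "(l, r) \<in> R \<Longrightarrow> vars r \<subseteq> vars l"
begin

lemma root_step_Fun: "root_step R s t \<Longrightarrow> \<exists>f ss g ts. s = Fun f ss \<and> t = Fun g ts \<and> f \<in> F \<and> g \<in> F"
proof -
  assume "root_step R s t"
  then obtain l r \<sigma> where lr: "(l, r) \<in> R" "s = subst \<sigma> l" "t = subst \<sigma> r"
    unfolding root_step_def by blast
  from rule_shape[OF lr(1)] obtain f ps g qs where "l = Fun f ps" "r = Fun g qs" "f \<in> F" "g \<in> F"
    by blast
  with lr(2,3) show ?thesis by simp
qed

text \<open>A redex has a control symbol at its root, and inner steps leave the root alone, so the
  constructor \<open>f\<close> stays for ever.\<close>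

lemma rsteps_constructor_iff:
  assumes "f \<notin> F"
  shows "rsteps R (Fun f ts) u \<longleftrightarrow> (\<exists>us. u = Fun f us \<and> list_all2 (rsteps R) ts us)"
proof
  assume "rsteps R (Fun f ts) u"
  then have "(inner_step R)\<^sup>*\<^sup>* (Fun f ts) u"
    unfolding rsteps_def
  proof (induction rule: rtranclp_induct)
    case (step u v)
    then obtain us where "u = Fun f us"
      unfolding inner_steps_Fun_iff by blast
    with step(2) have "inner_step R u v"
      using assms root_step_Fun[of u v] unfolding rstep_iff_root_or_inner by auto
    with step.IH show ?case by simp
  qed simp
  then show "\<exists>us. u = Fun f us \<and> list_all2 (rsteps R) ts us"
    unfolding inner_steps_Fun_iff .
qed (auto intro: rsteps_Fun)

lemma rsteps_Var:
  assumes "rsteps R (Var x) t"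
  shows "t = Var x"
proof -
  have no_step: "\<not> rstep R (Var x) u" for u
  proof
    assume "rstep R (Var x) u"
    moreover have "\<not> inner_step R (Var x) u"
      unfolding inner_step_def by simp
    ultimately have "root_step R (Var x) u"
      unfolding rstep_iff_root_or_inner by blast
    from root_step_Fun[OF this] show False by blast
  qed
  from assms have "(rstep R)\<^sup>*\<^sup>* (Var x) t"
    by (simp add: rsteps_def)
  then show ?thesis
    by (cases rule: converse_rtranclpE) (simp_all add: no_step)
qed

text \<open>Linearity gives each variable to one pattern, so the substitutions found for the single
  patterns can be glued. The result for single patterns is a hypothesis, because the lemma serves
  both inside the induction for \<open>rsteps_pattern\<close> and for the arguments of a left-hand
  side, whose root is a control symbol.\<close>

lemma rsteps_patterns:
  assumes args: "\<And>p u. p \<in> set ps \<Longrightarrow> rsteps R (subst \<sigma> p) u \<Longrightarrow>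
      \<exists>\<tau>. u = subst \<tau> p \<and> (\<forall>x. rsteps R (\<sigma> x) (\<tau> x))"
    and dist: "distinct (concat (map vars_list ps))"
    and us: "list_all2 (rsteps R) (map (subst \<sigma>) ps) us"
  shows "\<exists>\<tau>. us = map (subst \<tau>) ps \<and> (\<forall>x. rsteps R (\<sigma> x) (\<tau> x))"
proof -
  have len: "length us = length ps"
    using us by (auto dest: list_all2_lengthD)
  have "\<exists>\<tau>. us ! i = subst \<tau> (ps ! i) \<and> (\<forall>x. rsteps R (\<sigma> x) (\<tau> x))" if "i < length ps" for i
  proof (rule args)
    show "ps ! i \<in> set ps" using that by simp
    show "rsteps R (subst \<sigma> (ps ! i)) (us ! i)"
      using us that by (auto simp: list_all2_conv_all_nth)
  qed
  then have "\<forall>i. \<exists>\<tau>. i < length ps \<longrightarrow> us ! i = subst \<tau> (ps ! i) \<and> (\<forall>x. rsteps R (\<sigma> x) (\<tau> x))"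
    by blast
  from choice[OF this] obtain \<tau> where \<tau>: "\<And>i. i < length ps \<Longrightarrow> us ! i = subst (\<tau> i) (ps ! i)"
    "\<And>i x. i < length ps \<Longrightarrow> rsteps R (\<sigma> x) (\<tau> i x)"
    by blast
  \<comment> \<open>\<open>ix x\<close> is the unique pattern containing \<open>x\<close>. For a
    variable in no pattern it is arbitrary, which does no harm: both branches of
    \<open>\<theta>\<close> yield a reduct of \<open>\<sigma> x\<close>.\<close>
  define ix where "ix x = (SOME i. i < length ps \<and> x \<in> vars (ps ! i))" for x
  define \<theta> where "\<theta> x = (if ix x < length ps then \<tau> (ix x) x else \<sigma> x)" for x
  have ix: "ix x = i" if i: "i < length ps" and x: "x \<in> vars (ps ! i)" for i x
    unfolding ix_def
  proof (rule some_equality)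
    fix j assume j: "j < length ps \<and> x \<in> vars (ps ! j)"
    show "j = i"
    proof (rule ccontr)
      assume "j \<noteq> i"
      with distinct_concat_nth_disjoint[OF dist, of j i] i j
      have "vars (ps ! j) \<inter> vars (ps ! i) = {}"
        by (simp add: set_vars_list)
      with x j show False by blast
    qed
  qed (use i x in simp)
  have "us ! i = subst \<theta> (ps ! i)" if "i < length ps" for i
    unfolding \<tau>(1)[OF that]
  proof (rule subst_cong)
    fix x assume "x \<in> vars (ps ! i)"
    from ix[OF that this] that show "\<tau> i x = \<theta> x"
      by (simp add: \<theta>_def)
  qed
  then have "us = map (subst \<theta>) ps"
    using len by (simp add: list_eq_iff_nth_eq)
  moreover have "rsteps R (\<sigma> x) (\<theta> x)" for x
    unfolding \<theta>_def using \<tau>(2) by simp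
  ultimately show ?thesis by blast
qed

text \<open>No redex overlaps a pattern without control symbols, so every step happens inside a
  substituted term, and by linearity these terms evolve independently.\<close>

lemma rsteps_pattern:
  assumes "funs p \<inter> F = {}" "distinct (vars_list p)" "rsteps R (subst \<sigma> p) u"
  shows "\<exists>\<tau>. u = subst \<tau> p \<and> (\<forall>x. rsteps R (\<sigma> x) (\<tau> x))"
  using assms
proof (induction p arbitrary: u)
  case (Var x)
  then show ?case
    by (intro exI[of _ "\<sigma>(x := u)"]) auto
next
  case (Fun f ps)
  from Fun.prems obtain us where us: "u = Fun f us" "list_all2 (rsteps R) (map (subst \<sigma>) ps) us"
    by (auto simp: rsteps_constructor_iff)
  have "\<exists>\<tau>. us = map (subst \<tau>) ps \<and> (\<forall>x. rsteps R (\<sigma> x) (\<tau> x))"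
  proof (rule rsteps_patterns)
    fix p u assume p: "p \<in> set ps" and u: "rsteps R (subst \<sigma> p) u"
    from p Fun.prems(1) have "funs p \<inter> F = {}" by auto
    moreover from p Fun.prems(2) have "distinct (vars_list p)"
      by (auto simp: distinct_concat_iff)
    ultimately show "\<exists>\<tau>. u = subst \<tau> p \<and> (\<forall>x. rsteps R (\<sigma> x) (\<tau> x))"
      using Fun.IH[OF p _ _ u] by blast
  qed (use Fun.prems us in auto)
  with us(1) show ?case by auto
qed

text \<open>Inner steps only change the substitution, so the same rule still applies afterwards.
  Duplication or erasure of variables affects the number of inner steps only; the root step remains
  a single one, which makes the extension to sequences a plain induction.\<close>

lemma root_inner_commute_step:
  assumes "root_step R s t" "(inner_step R)\<^sup>*\<^sup>* s s'"
  shows "\<exists>t'. root_step R s' t' \<and> (inner_step R)\<^sup>*\<^sup>* t t'"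
proof -
  from assms(1) obtain l r \<sigma> where lr: "(l, r) \<in> R" "s = subst \<sigma> l" "t = subst \<sigma> r"
    unfolding root_step_def by blast
  from rule_shape[OF lr(1)] obtain f ps g qs where sh: "l = Fun f ps" "r = Fun g qs"
    "\<And>p. p \<in> set ps \<Longrightarrow> funs p \<inter> F = {}"
    by blast
  obtain us where us: "s' = Fun f us" "list_all2 (rsteps R) (map (subst \<sigma>) ps) us"
    using assms(2) unfolding lr(2) sh(1) by (auto simp: inner_steps_Fun_iff)
  have dist: "distinct (concat (map vars_list ps))"
    using left_linear[OF lr(1)] by (simp add: sh(1))
  have "\<exists>\<tau>. us = map (subst \<tau>) ps \<and> (\<forall>x. rsteps R (\<sigma> x) (\<tau> x))"
  proof (rule rsteps_patterns[OF _ dist us(2)])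
    fix p u assume p: "p \<in> set ps" and u: "rsteps R (subst \<sigma> p) u"
    from p dist have "distinct (vars_list p)"
      by (auto simp: distinct_concat_iff)
    from rsteps_pattern[OF sh(3)[OF p] this u]
    show "\<exists>\<tau>. u = subst \<tau> p \<and> (\<forall>x. rsteps R (\<sigma> x) (\<tau> x))" .
  qed
  then obtain \<tau> where \<tau>: "us = map (subst \<tau>) ps" "\<And>x. rsteps R (\<sigma> x) (\<tau> x)"
    by blast
  have "root_step R s' (subst \<tau> r)"
    unfolding root_step_def using lr(1) us(1) \<tau>(1) sh(1) by force
  moreover have "(inner_step R)\<^sup>*\<^sup>* t (subst \<tau> r)"
    unfolding lr(3) sh(2) using \<tau>(2)
    by (auto simp: inner_steps_Fun_iff list_all2_conv_all_nth intro: rsteps_subst)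
  ultimately show ?thesis by blast
qed

lemma root_inner_commute:
  assumes "(root_step R)\<^sup>*\<^sup>* s t" "(inner_step R)\<^sup>*\<^sup>* s s'"
  shows "\<exists>t'. (root_step R)\<^sup>*\<^sup>* s' t' \<and> (inner_step R)\<^sup>*\<^sup>* t t'"
  using assms(1)
proof (induction rule: rtranclp_induct)
  case base
  then show ?case using assms(2) by blast
next
  case (step t u)
  then obtain t' where t': "(root_step R)\<^sup>*\<^sup>* s' t'" "(inner_step R)\<^sup>*\<^sup>* t t'" by blast
  obtain u' where "root_step R t' u'" "(inner_step R)\<^sup>*\<^sup>* u u'"
    using root_inner_commute_step[OF step(2) t'(2)] by blast
  with t'(1) show ?case
    by (blast intro: rtranclp.rtrancl_into_rtrancl)
qed

lemma confluent_on_constructor_iff: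
  assumes "f \<notin> F"
  shows "confluent_on R (Fun f ts) \<longleftrightarrow> (\<forall>t \<in> set ts. confluent_on R t)"
proof
  assume conf: "confluent_on R (Fun f ts)"
  show "\<forall>t \<in> set ts. confluent_on R t"
  proof
    fix t assume "t \<in> set ts"
    then obtain i where i: "i < length ts" "ts ! i = t"
      by (auto simp: in_set_conv_nth)
    show "confluent_on R t"
      unfolding confluent_on_def
    proof (intro allI impI)
      fix t1 t2 assume "rsteps R t t1 \<and> rsteps R t t2"
      then have "rsteps R (Fun f ts) (Fun f (ts[i := t1]))" "rsteps R (Fun f ts) (Fun f (ts[i := t2]))"
        using i by (auto intro!: rsteps_Fun simp: list_all2_conv_all_nth nth_list_update)
      then obtain d where "rsteps R (Fun f (ts[i := t1])) d" "rsteps R (Fun f (ts[i := t2])) d"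
        using conf unfolding confluent_on_def by blast
      then obtain ds where "list_all2 (rsteps R) (ts[i := t1]) ds" "list_all2 (rsteps R) (ts[i := t2]) ds"
        unfolding rsteps_constructor_iff[OF assms] by blast
      then have "rsteps R t1 (ds ! i) \<and> rsteps R t2 (ds ! i)"
        using i unfolding list_all2_conv_all_nth by (metis nth_list_update_eq length_list_update)
      then show "\<exists>d. rsteps R t1 d \<and> rsteps R t2 d" by blast
    qed
  qed
next
  assume "\<forall>t \<in> set ts. confluent_on R t"
  note join = list_all2_rsteps_join[OF this]
  show "confluent_on R (Fun f ts)"
    unfolding confluent_on_def
  proof (intro allI impI)
    fix t1 t2 assume "rsteps R (Fun f ts) t1 \<and> rsteps R (Fun f ts) t2"
    then obtain us vs where "t1 = Fun f us" "list_all2 (rsteps R) ts us"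
      "t2 = Fun f vs" "list_all2 (rsteps R) ts vs"
      unfolding rsteps_constructor_iff[OF assms] by blast
    with join show "\<exists>d. rsteps R t1 d \<and> rsteps R t2 d"
      by (blast intro: rsteps_Fun)
  qed
qed

text \<open>Read from left to right for the arguments of a left-hand side and from right to left for
  those of the right-hand side, it shows that root steps preserve confluence of the
  arguments.\<close>

lemma confluent_on_subst_iff:
  assumes "funs p \<inter> F = {}"
  shows "confluent_on R (subst \<sigma> p) \<longleftrightarrow> (\<forall>x \<in> vars p. confluent_on R (\<sigma> x))"
  using assms
proof (induction p)
  case (Fun f ps)
  then have f: "f \<notin> F" by simp
  have "confluent_on R (subst \<sigma> p) \<longleftrightarrow> (\<forall>x \<in> vars p. confluent_on R (\<sigma> x))" if "p \<in> set ps" for p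
    using Fun.IH[OF that] Fun.prems that by auto
  then show ?case
    by (simp add: confluent_on_constructor_iff[OF f])
qed simp

text \<open>By structural induction the arguments are confluent, so inner steps can be joined; root
  steps can be joined by assumption, and the two kinds commute. Hence blocks of root steps followed
  by inner steps have the diamond property.\<close>

theorem confluent_if_root_confluent:
  assumes "confluentp (root_step R)"
  shows "confluent_on R t"
proof (induction t)
  case (Var x)
  show ?case
    unfolding confluent_on_def using rsteps_Var rsteps_refl by blast
next
  case (Fun f ts)
  show ?case
  proof (cases "f \<in> F")
    case False
    then show ?thesis
      using Fun by (simp add: confluent_on_constructor_iff)
  next
    case True
    \<comment> \<open>The symbol \<open>g\<close> is left open: root steps change the control symbol
      and the arguments, so the induction hypothesis on \<open>ts\<close> has to become an invariant
      of the whole reduction.\<close>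
    define Y where "Y = {Fun g us | g us. \<forall>u \<in> set us. confluent_on R u}"
    have Y_root: "t \<in> Y" if "root_step R s t" "s \<in> Y" for s t
    proof -
      from that(1) obtain l r \<sigma> where lr: "(l, r) \<in> R" "s = subst \<sigma> l" "t = subst \<sigma> r"
        unfolding root_step_def by blast
      from rule_shape[OF lr(1)] obtain f ps g qs where sh: "l = Fun f ps" "r = Fun g qs"
        "\<And>p. p \<in> set ps \<Longrightarrow> funs p \<inter> F = {}" "\<And>q. q \<in> set qs \<Longrightarrow> funs q \<inter> F = {}"
        by blast
      have "\<forall>p \<in> set ps. confluent_on R (subst \<sigma> p)"
        using that(2) by (auto simp: Y_def lr sh)
      then have "\<forall>x \<in> vars l. confluent_on R (\<sigma> x)"
        using sh(3) by (auto simp: sh(1) confluent_on_subst_iff)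
      then have "\<forall>x \<in> vars r. confluent_on R (\<sigma> x)"
        using vars_rule[OF lr(1)] by blast
      then have "\<forall>q \<in> set qs. confluent_on R (subst \<sigma> q)"
        using sh(4) by (auto simp: sh(2) confluent_on_subst_iff)
      then show ?thesis
        by (auto simp: Y_def lr(3) sh(2))
    qed
    have Y_roots: "t \<in> Y" if "(root_step R)\<^sup>*\<^sup>* s t" "s \<in> Y" for s t
      using that by (induction rule: rtranclp_induct) (auto intro: Y_root)
    have Y_inners: "t \<in> Y" if st: "(inner_step R)\<^sup>*\<^sup>* s t" and "s \<in> Y" for s t
    proof -
      obtain g us where s: "s = Fun g us" "\<forall>u \<in> set us. confluent_on R u"
        using \<open>s \<in> Y\<close> by (auto simp: Y_def)
      then obtain vs where t: "t = Fun g vs" "list_all2 (rsteps R) us vs"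
        using st by (auto simp: inner_steps_Fun_iff)
      have "confluent_on R v" if "v \<in> set vs" for v
      proof -
        obtain u where "u \<in> set us" "rsteps R u v"
          using t(2) \<open>v \<in> set vs\<close> by (metis in_set_conv_nth list_all2_conv_all_nth)
        with s(2) show ?thesis
          unfolding confluent_on_def by (meson rsteps_trans)
      qed
      then show ?thesis by (auto simp: Y_def t)
    qed
    have inner_join: "\<exists>d. (inner_step R)\<^sup>*\<^sup>* t d \<and> (inner_step R)\<^sup>*\<^sup>* u d"
      if stu: "(inner_step R)\<^sup>*\<^sup>* s t" "(inner_step R)\<^sup>*\<^sup>* s u" and "s \<in> Y" for s t u
    proof -
      obtain g ss where s: "s = Fun g ss" "\<forall>u \<in> set ss. confluent_on R u"
        using \<open>s \<in> Y\<close> by (auto simp: Y_def)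
      then obtain ts us where "t = Fun g ts" "list_all2 (rsteps R) ss ts"
        "u = Fun g us" "list_all2 (rsteps R) ss us"
        using stu by (auto simp: inner_steps_Fun_iff)
      with list_all2_rsteps_join[OF s(2)] show ?thesis
        by (metis inner_steps_Fun_iff)
    qed
    \<comment> \<open>The conjunct \<open>s \<in> Y\<close> keeps \<open>C\<close> where inner steps
      can be joined. On \<open>Y\<close> every rewrite step is a \<open>C\<close> step, and every
      \<open>C\<close> step is a reduction, so confluence of \<open>C\<close> suffices.\<close>
    define C where "C s t \<longleftrightarrow> s \<in> Y \<and> (\<exists>u. (root_step R)\<^sup>*\<^sup>* s u \<and> (inner_step R)\<^sup>*\<^sup>* u t)" for s t
    have "strong_confluentp C"
    proof (rule strong_confluentpI)
      fix s t1 t2 assume "C s t1" "C s t2"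
      then obtain u1 u2 where s: "s \<in> Y" and
        u1: "(root_step R)\<^sup>*\<^sup>* s u1" "(inner_step R)\<^sup>*\<^sup>* u1 t1" and
        u2: "(root_step R)\<^sup>*\<^sup>* s u2" "(inner_step R)\<^sup>*\<^sup>* u2 t2"
        unfolding C_def by blast
      obtain e where e: "(root_step R)\<^sup>*\<^sup>* u1 e" "(root_step R)\<^sup>*\<^sup>* u2 e"
        using confluentpD[OF assms u1(1) u2(1)] by blast
      obtain e1 where e1: "(root_step R)\<^sup>*\<^sup>* t1 e1" "(inner_step R)\<^sup>*\<^sup>* e e1"
        using root_inner_commute[OF e(1) u1(2)] by blast
      obtain e2 where e2: "(root_step R)\<^sup>*\<^sup>* t2 e2" "(inner_step R)\<^sup>*\<^sup>* e e2"
        using root_inner_commute[OF e(2) u2(2)] by blast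
      have "e \<in> Y" using Y_roots[OF e(1) Y_roots[OF u1(1) s]] .
      then obtain d where "(inner_step R)\<^sup>*\<^sup>* e1 d" "(inner_step R)\<^sup>*\<^sup>* e2 d"
        using inner_join e1(2) e2(2) by blast
      moreover have "t1 \<in> Y" "t2 \<in> Y"
        using Y_inners[OF u1(2) Y_roots[OF u1(1) s]] Y_inners[OF u2(2) Y_roots[OF u2(1) s]] .
      ultimately have "C t1 d" "C t2 d" using e1 e2 unfolding C_def by blast+
      then show "\<exists>d. C\<^sup>*\<^sup>* t1 d \<and> C\<^sup>=\<^sup>= t2 d"
        by (meson r_into_rtranclp sup2I1)
    qed
    then have conf: "confluentp C" by (rule strong_confluentp_imp_confluentp)
    have tY: "Fun f ts \<in> Y" using Fun by (auto simp: Y_def)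
    have to_C: "C\<^sup>*\<^sup>* s t \<and> t \<in> Y" if "rsteps R s t" "s \<in> Y" for s t
      using that unfolding rsteps_def
    proof (induction rule: rtranclp_induct)
      case (step t u)
      from step have "(root_step R)\<^sup>*\<^sup>* t u \<or> (inner_step R)\<^sup>*\<^sup>* t u"
        unfolding rstep_iff_root_or_inner by auto
      with step have tu: "C t u"
        unfolding C_def by (meson rtranclp.rtrancl_refl)
      then obtain v where "t \<in> Y" "(root_step R)\<^sup>*\<^sup>* t v" "(inner_step R)\<^sup>*\<^sup>* v u"
        unfolding C_def by blast
      then have "u \<in> Y" using Y_inners Y_roots by blast
      with step tu show ?case by auto
    qed simp
    have of_C: "rsteps R s t" if "C\<^sup>*\<^sup>* s t" for s t
      using that
    proof (induction rule: rtranclp_induct)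
      case (step t u)
      then obtain v where "(root_step R)\<^sup>*\<^sup>* t v" "(inner_step R)\<^sup>*\<^sup>* v u"
        unfolding C_def by blast
      then have "rsteps R t u"
        using root_steps_imp_rsteps inner_steps_imp_rsteps rsteps_trans by blast
      with step.IH show ?case by (rule rsteps_trans)
    qed simp
    show ?thesis
      unfolding confluent_on_def
    proof (intro allI impI)
      fix t1 t2 assume "rsteps R (Fun f ts) t1 \<and> rsteps R (Fun f ts) t2"
      then have "C\<^sup>*\<^sup>* (Fun f ts) t1" "C\<^sup>*\<^sup>* (Fun f ts) t2"
        using to_C tY by blast+
      from confluentpD[OF conf this] show "\<exists>d. rsteps R t1 d \<and> rsteps R t2 d"
        using of_C by blast
    qed
  qed
qed

end

section \<open>Codes of terms and rewrite systems\<close>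

lemma enc_term_inject [simp]: "enc_term s = enc_term t \<longleftrightarrow> s = t"
proof
  show "enc_term s = enc_term t \<Longrightarrow> s = t"
  proof (induction s arbitrary: t)
    case (Var x)
    then show ?case by (cases t) (auto simp: prod_encode_eq)
  next
    case (Fun f ss)
    then obtain ts where t: "t = Fun f ts" "map enc_term ss = map enc_term ts"
      by (cases t) (auto simp: prod_encode_eq list_encode_eq)
    have "ss = ts"
      by (rule list.inj_map_strong[OF _ t(2)]) (use Fun.IH in auto)
    with t show ?case by simp
  qed
qed simp


lemma enc_trs_inject: "enc_trs sig rs = enc_trs sig' rs' \<longleftrightarrow> sig = sig' \<and> rs = rs'"
proof -
  have "inj (\<lambda>(l, r). prod_encode (enc_term l, enc_term r))"
    by (auto simp: inj_def prod_encode_eq)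
  then show ?thesis
    by (auto simp: enc_trs_def prod_encode_eq list_encode_eq inj_map_eq_map inj_prod_encode)
qed

lemma enc_trs_mem_codes_iff:
  "enc_trs sig rs \<in> trs_property_codes P \<longleftrightarrow> is_trs (set sig) (set rs) \<and> P (set sig) (set rs)"
  unfolding trs_property_codes_def by (auto simp: enc_trs_inject)

section \<open>Inference systems over numbers\<close>

text \<open>Expressions built from environment variables, constants, pairs and successors.
  Successors occur because \<open>list_encode\<close> codes a nonempty list as the successor of a
  pair.\<close>

datatype pexp = PV nat | PC nat | PP pexp pexp | PS pexp

primrec entry :: "nat \<Rightarrow> nat \<Rightarrow> nat" where
  "entry 0 v = pfst v"
| "entry (Suc i) v = entry i (psnd v)"

primrec pval :: "nat \<Rightarrow> pexp \<Rightarrow> nat" where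
  "pval v (PV i) = entry i v"
| "pval v (PC c) = c"
| "pval v (PP a b) = prod_encode (pval v a, pval v b)"
| "pval v (PS a) = Suc (pval v a)"

type_synonym schema = "pexp \<times> pexp \<times> pexp"

text \<open>Slots 0 and 1 hold the two halves of the input, for a rewrite system its signature and
  its rules; the variables of a schema start at slot 2.\<close>

definition env :: "nat \<Rightarrow> nat \<Rightarrow> nat" where
  "env x v = prod_encode (pfst x, prod_encode (psnd x, v))"

inductive derivable :: "schema list \<Rightarrow> nat \<Rightarrow> nat \<Rightarrow> bool" for qs x where
  trivial: "derivable qs x 0"
| schema: "(A, B, C) \<in> set qs \<Longrightarrow> derivable qs x (pval (env x v) A) \<Longrightarrow> derivable qs x (pval (env x v) B) \<Longrightarrow>
    derivable qs x (pval (env x v) C)"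

text \<open>\<open>rest\<close> is decoded blindly. Rebuilding the stack from the two expected
  premises and comparing it with \<open>st\<close> validates the decoding and replaces pattern
  matching.\<close>

definition apply_schema :: "schema \<Rightarrow> nat \<Rightarrow> nat \<Rightarrow> nat" where
  "apply_schema q e st = (let rest = psnd (psnd (st - 1) - 1) in
     if st = Suc (prod_encode (pval e (fst q), Suc (prod_encode (pval e (fst (snd q)), rest))))
     then Suc (prod_encode (pval e (snd (snd q)), rest)) else st)"

primrec select_schema :: "schema list \<Rightarrow> nat \<Rightarrow> nat \<Rightarrow> nat \<Rightarrow> nat" where
  "select_schema [] k e st = st"
| "select_schema (q # qs) k e st = (if k = 0 then apply_schema q e st else select_schema qs (k - 1) e st)"

text \<open>An instruction pairs an opcode with values for the schema variables: 0 pushes the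
  trivial judgement, \<open>Suc k\<close> applies schema \<open>k\<close>. Instructions that do not
  fit leave the stack alone, so every number is a sound program.\<close>

definition exec :: "schema list \<Rightarrow> nat \<Rightarrow> nat \<Rightarrow> nat \<Rightarrow> nat" where
  "exec qs x st i = (if pfst i = 0 then Suc (prod_encode (0, st))
     else select_schema qs (pfst i - 1) (env x (psnd i)) st)"

definition run_step :: "schema list \<Rightarrow> nat \<Rightarrow> nat" where
  "run_step qs w = (if pfst (psnd w) = 0 then w else
     prod_encode (pfst w, prod_encode (psnd (pfst (psnd w) - 1),
       exec qs (pfst w) (psnd (psnd w)) (pfst (pfst (psnd w) - 1)))))"

text \<open>A derivation is given in postfix notation, as the code of a list of instructions for a stack machine.
  The code is an upper bound for the length of the list, so it can serve as the number of iterations.\<close>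

definition run :: "schema list \<Rightarrow> nat \<Rightarrow> nat \<Rightarrow> nat" where
  "run qs x p = psnd (psnd ((run_step qs ^^ p) (prod_encode (x, prod_encode (p, 0)))))"

lemma run_step_simps [simp]:
  "run_step qs (prod_encode (x, prod_encode (0, st))) = prod_encode (x, prod_encode (0, st))"
  "run_step qs (prod_encode (x, prod_encode (Suc (prod_encode (i, p)), st))) =
     prod_encode (x, prod_encode (p, exec qs x st i))"
  by (simp_all add: run_step_def)

lemma run_step_iter:
  "(run_step qs ^^ n) (prod_encode (x, prod_encode (list_encode is, st))) =
     prod_encode (x, prod_encode (list_encode (drop n is), foldl (exec qs x) st (take n is)))"
proof (induction n arbitrary: "is" st)
  case (Suc n)
  show ?case
    by (cases "is") (simp_all add: funpow_Suc_right Suc[of "[]", simplified] Suc del: funpow.simps)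
qed simp

lemma length_le_list_encode: "length xs \<le> list_encode xs"
proof (induction xs)
  case (Cons a xs)
  then show ?case
    using le_prod_encode_2[of "list_encode xs" a] by simp
qed simp

lemma run_list_encode: "run qs x (list_encode is) = foldl (exec qs x) 0 is"
  unfolding run_def run_step_iter[of _ _ _ "is"] by (simp add: length_le_list_encode)

lemma exec_sound:
  assumes "\<forall>j \<in> set (list_decode st). derivable qs x j"
  shows "\<forall>j \<in> set (list_decode (exec qs x st i)). derivable qs x j"
proof -
  have ap: "\<forall>j \<in> set (list_decode (apply_schema q (env x v) st)). derivable qs x j" if "q \<in> set qs" for q v
  proof -
    obtain A B C where q: "q = (A, B, C)" by (cases q)
    define rest where "rest = psnd (psnd (st - 1) - 1)"
    have eq: "apply_schema q (env x v) st =
        (if st = Suc (prod_encode (pval (env x v) A, Suc (prod_encode (pval (env x v) B, rest))))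
         then Suc (prod_encode (pval (env x v) C, rest)) else st)"
      by (simp add: apply_schema_def q Let_def rest_def)
    show ?thesis
    proof (cases "st = Suc (prod_encode (pval (env x v) A, Suc (prod_encode (pval (env x v) B, rest))))")
      case True
      then have "derivable qs x (pval (env x v) A)" "derivable qs x (pval (env x v) B)"
        "\<forall>j \<in> set (list_decode rest). derivable qs x j"
        using assms by simp_all
      with derivable.schema[of A B C qs x v] \<open>q \<in> set qs\<close> True show ?thesis
        unfolding eq by (simp add: q)
    next
      case False
      then show ?thesis
        using assms by (simp add: eq)
    qed
  qed
  have sel: "\<forall>j \<in> set (list_decode (select_schema qs' k (env x v) st)). derivable qs x j"
    if "set qs' \<subseteq> set qs" for qs' k v
    using that by (induction qs' arbitrary: k) (use ap assms in auto)
  show ?thesis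
    using sel assms by (auto simp: exec_def derivable.trivial)
qed

lemma select_schema_nth: "k < length qs \<Longrightarrow> select_schema qs k e st = apply_schema (qs ! k) e st"
  by (induction qs arbitrary: k) (auto simp: nth_Cons split: nat.splits)

lemma derivable_iff_run: "derivable qs x j \<longleftrightarrow> (\<exists>p. run qs x p = Suc (prod_encode (j, 0)))"
proof
  assume "derivable qs x j"
  \<comment> \<open>The program must push \<open>j\<close> on an arbitrary stack, so that programs
    for premises can be concatenated.\<close>
  then have "\<exists>is. \<forall>st. foldl (exec qs x) st is = Suc (prod_encode (j, st))"
  proof induction
    case trivial
    have "\<forall>st. foldl (exec qs x) st [prod_encode (0, 0)] = Suc (prod_encode (0, st))"
      by (simp add: exec_def)
    then show ?case by blast
  next
    case (schema A B C v)
    then obtain as bs where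
      as: "\<And>st. foldl (exec qs x) st as = Suc (prod_encode (pval (env x v) A, st))" and
      bs: "\<And>st. foldl (exec qs x) st bs = Suc (prod_encode (pval (env x v) B, st))"
      by blast
    obtain k where "k < length qs" "qs ! k = (A, B, C)"
      using schema(1) by (auto simp: in_set_conv_nth)
    \<comment> \<open>The second premise is derived before the first, because
      \<open>apply_schema\<close> expects the first one on top.\<close>
    then have "\<forall>st. foldl (exec qs x) st (bs @ as @ [prod_encode (Suc k, v)]) =
        Suc (prod_encode (pval (env x v) C, st))"
      by (simp add: as bs exec_def select_schema_nth apply_schema_def Let_def)
    then show ?case by blast
  qed
  then show "\<exists>p. run qs x p = Suc (prod_encode (j, 0))"
    using run_list_encode by metis
next
  assume "\<exists>p. run qs x p = Suc (prod_encode (j, 0))"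
  then obtain p where p: "run qs x p = Suc (prod_encode (j, 0))" by blast
  have "\<forall>j \<in> set (list_decode (foldl (exec qs x) st is)). derivable qs x j"
    if "\<forall>j \<in> set (list_decode st). derivable qs x j" for st "is"
    using that
  proof (induction "is" arbitrary: st)
    case (Cons i js)
    from Cons.IH[OF exec_sound[OF Cons.prems]] show ?case by simp
  qed simp
  from this[of 0 "list_decode p"] have "\<forall>j \<in> set (list_decode (run qs x p)). derivable qs x j"
    by (simp flip: run_list_encode)
  then show "derivable qs x j" by (simp add: p)
qed

section \<open>Computability of the stack machine\<close>

lemma computable_entry: "total_computable f \<Longrightarrow> total_computable (\<lambda>w. entry i (f w))"
  by (induction i arbitrary: f) (simp_all add: computable_pfst computable_psnd)

lemma computable_pval: "total_computable f \<Longrightarrow> total_computable (\<lambda>w. pval (f w) a)"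
  by (induction a) (simp_all add: computable_entry computable_const computable_pair computable_Suc)

lemma computable_apply_schema:
  "total_computable e \<Longrightarrow> total_computable st \<Longrightarrow> total_computable (\<lambda>w. apply_schema q (e w) (st w))"
  unfolding apply_schema_def Let_def
  by (intro computable_if_eq computable_Suc computable_pair computable_pval computable_psnd computable_minus_1)

lemma computable_select_schema:
  "total_computable k \<Longrightarrow> total_computable e \<Longrightarrow> total_computable st \<Longrightarrow>
    total_computable (\<lambda>w. select_schema qs (k w) (e w) (st w))"
proof (induction qs arbitrary: k)
  case (Cons q qs)
  show ?case
    unfolding select_schema.simps
    by (intro computable_if0 computable_apply_schema Cons.IH Cons.prems computable_minus_1)
qed simp

lemma computable_run_step: "total_computable (run_step qs)"
  unfolding run_step_def[abs_def] exec_def env_def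
  by (intro computable_if0 computable_select_schema computable_pair computable_Suc computable_pfst
      computable_psnd computable_minus_1 computable_const computable_id)

lemma computable_run:
  "total_computable f \<Longrightarrow> total_computable g \<Longrightarrow> total_computable (\<lambda>w. run qs (f w) (g w))"
  unfolding run_def
  by (intro computable_psnd computable_iter computable_run_step computable_pair computable_const)

section \<open>Judgements about coded terms and rewrite systems\<close>

abbreviation pr :: "nat \<Rightarrow> nat \<Rightarrow> nat" where "pr a b \<equiv> prod_encode (a, b)"
abbreviation "cVar y \<equiv> pr 0 y"
abbreviation "cFun f ts \<equiv> pr (Suc 0) (pr f ts)"
abbreviation "jSig l \<equiv> pr 2 l"
abbreviation "jArity a \<equiv> pr 3 a"
abbreviation "jRules l \<equiv> pr 4 l"
abbreviation "jLook \<sigma> i t \<equiv> pr 5 (pr \<sigma> (pr i t))"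
abbreviation "jRel m s t \<equiv> pr 6 (pr m (pr s t))"
text \<open>The length \<open>n\<close> is carried along so that \<open>Rel_Fun\<close> can check
  the arity of \<open>f\<close> against the signature.\<close>

abbreviation "jRels m n ss ts \<equiv> pr 7 (pr m (pr n (pr ss ts)))"
abbreviation "jVar y t \<equiv> pr 8 (pr y t)"
abbreviation "jVars y ts \<equiv> pr 9 (pr y ts)"
text \<open>A root step depends on three facts: the rule and the instances of its two sides. As a
  schema has only two premises, the first two facts are merged into this judgement.\<close>

abbreviation "jRedex \<sigma> r l \<equiv> pr 10 (pr \<sigma> (pr r l))"
abbreviation "jRule l r \<equiv> pr 11 (pr l r)"
abbreviation "jTrs rs \<equiv> pr 12 rs"
abbreviation "steps_mode \<equiv> pr 2 0"
abbreviation "inst_mode \<sigma> \<equiv> pr 3 \<sigma>"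
abbreviation "vars_mode l \<equiv> pr 4 l"

text \<open>The judgement \<open>0\<close> is trivially true and fills unused premises, so that every rule has two.
  \<open>jRel m s t\<close> has three readings: \<open>s \<rightarrow>\<^sup>* t\<close> for \<open>steps_mode\<close>, \<open>t = s\<sigma>\<close> for \<open>inst_mode \<sigma>\<close>, and \<open>s = t\<close> with all
  variables occurring in \<open>l\<close> for \<open>vars_mode l\<close>; each reading includes well-formedness of \<open>s\<close> and \<open>t\<close>.\<close>

inductive jrule :: "nat \<Rightarrow> nat \<Rightarrow> nat \<Rightarrow> nat \<Rightarrow> bool" for x where
  Sig: "jrule x 0 0 (jSig (pfst x))"
| Sig_tl: "jrule x (jSig (Suc (pr a l))) 0 (jSig l)"
| Arity: "jrule x (jSig (Suc (pr a l))) 0 (jArity a)"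
| Rules: "jrule x 0 0 (jRules (psnd x))"
| Rules_tl: "jrule x (jRules (Suc (pr a l))) 0 (jRules l)"
| Look_0: "jrule x (jRel steps_mode t t) 0 (jLook (Suc (pr t \<sigma>)) 0 t)"
| Look_Suc: "jrule x (jLook \<sigma> i t) 0 (jLook (Suc (pr u \<sigma>)) (Suc i) t)"
| Steps_Var: "jrule x 0 0 (jRel steps_mode (cVar y) (cVar y))"
| Inst_Var: "jrule x (jLook \<sigma> i t) 0 (jRel (inst_mode \<sigma>) (cVar i) t)"
| Vars_Var: "jrule x (jVar y l) 0 (jRel (vars_mode l) (cVar y) (cVar y))"
| Rels_Nil: "jrule x 0 0 (jRels m 0 0 0)"
| Rels_Cons: "jrule x (jRel m s t) (jRels m n ss ts) (jRels m (Suc n) (Suc (pr s ss)) (Suc (pr t ts)))"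
| Rel_Fun: "jrule x (jRels m n ss ts) (jArity (pr f n)) (jRel m (cFun f ss) (cFun f ts))"
| Steps_trans: "jrule x (jRel steps_mode s t) (jRel steps_mode t u) (jRel steps_mode s u)"
| Redex: "jrule x (jRules (Suc (pr (pr l r) b))) (jRel (inst_mode \<sigma>) l s) (jRedex \<sigma> r s)"
| Steps_root: "jrule x (jRedex \<sigma> r s) (jRel (inst_mode \<sigma>) r t) (jRel steps_mode s t)"
| Var: "jrule x 0 0 (jVar y (cVar y))"
| Var_Fun: "jrule x (jVars y ts) 0 (jVar y (cFun f ts))"
| Vars_hd: "jrule x (jVar y t) 0 (jVars y (Suc (pr t ts)))"
| Vars_tl: "jrule x (jVars y ts) 0 (jVars y (Suc (pr t ts)))"
| Rule: "jrule x (jRel steps_mode (cFun f ts) (cFun f ts)) (jRel (vars_mode (cFun f ts)) r r) (jRule (cFun f ts) r)"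
| Trs_Nil: "jrule x 0 0 (jTrs 0)"
| Trs_Cons: "jrule x (jRule l r) (jTrs rs) (jTrs (Suc (pr (pr l r) rs)))"

text \<open>The constructors of \<open>jrule\<close> in the same order, now as syntax: this list is
  what the stack machine executes, whereas \<open>jrule\<close> is what proofs do case analysis
  on.\<close>

definition judgement_schemas :: "schema list" where
  "judgement_schemas = (let K = PP; t = (\<lambda>n a. PP (PC n) a); z = PC 0; a = PV 2; b = PV 3; c = PV 4; d = PV 5;
      e = PV 6; f = PV 7; cvar = PP (PC 0); cfun = (\<lambda>f ts. PP (PC (Suc 0)) (PP f ts));
      look = (\<lambda>s i u. t 5 (K s (K i u))); rel = (\<lambda>m s u. t 6 (K m (K s u)));
      rels = (\<lambda>m n s u. t 7 (K m (K n (K s u)))); st = PP (PC 2) (PC 0) in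
    [(z, z, t 2 (PV 0)),
     (t 2 (PS (K a b)), z, t 2 b),
     (t 2 (PS (K a b)), z, t 3 a),
     (z, z, t 4 (PV 1)),
     (t 4 (PS (K a b)), z, t 4 b),
     (rel st a a, z, look (PS (K a b)) z a),
     (look a b c, z, look (PS (K d a)) (PS b) c),
     (z, z, rel st (cvar a) (cvar a)),
     (look a b c, z, rel (t 3 a) (cvar b) c),
     (t 8 (K a b), z, rel (t 4 b) (cvar a) (cvar a)),
     (z, z, rels a z z z),
     (rel a b c, rels a d e f, rels a (PS d) (PS (K b e)) (PS (K c f))),
     (rels a b c d, t 3 (K e b), rel a (cfun e c) (cfun e d)),
     (rel st a b, rel st b c, rel st a c),
     (t 4 (PS (K (K a b) c)), rel (t 3 d) a e, t 10 (K d (K b e))),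
     (t 10 (K a (K b c)), rel (t 3 a) b d, rel st c d),
     (z, z, t 8 (K a (cvar a))),
     (t 9 (K a b), z, t 8 (K a (cfun c b))),
     (t 8 (K a b), z, t 9 (K a (PS (K b c)))),
     (t 9 (K a b), z, t 9 (K a (PS (K c b)))),
     (rel st (cfun a b) (cfun a b), rel (t 4 (cfun a b)) c c, t 11 (K (cfun a b) c)),
     (z, z, t 12 z),
     (t 11 (K a b), t 12 c, t 12 (PS (K (K a b) c)))])"

abbreviation derives :: "nat \<Rightarrow> nat \<Rightarrow> bool" where
  "derives \<equiv> derivable judgement_schemas"

lemma judgement_schemas_jrule:
  assumes "(A, B, C) \<in> set judgement_schemas"
  shows "jrule x (pval (env x v) A) (pval (env x v) B) (pval (env x v) C)"
  using assms unfolding judgement_schemas_def Let_def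
  by (auto simp: env_def intro: jrule.intros)

primrec tuple :: "nat list \<Rightarrow> nat" where
  "tuple [] = 0"
| "tuple (a # as) = pr a (tuple as)"

lemma derives_jrule:
  assumes "jrule x a b c" "derives x a" "derives x b"
  shows "derives x c"
proof -
  \<comment> \<open>\<open>as\<close> lists the values of the schema variables from slot 2 onwards;
    the matching schema is then found by evaluating the whole list.\<close>
  have I: "derives x c"
    if "\<exists>(A, B, C) \<in> set judgement_schemas. pval (env x (tuple as)) A = a \<and> pval (env x (tuple as)) B = b \<and>
      pval (env x (tuple as)) C = c" for as
    using that assms(2,3) derivable.schema[of _ _ _ judgement_schemas x "tuple as"] by auto
  note simps = judgement_schemas_def Let_def env_def numeral_eq_Suc
  from assms(1) show ?thesis
  proof cases
    case Sig
    then show ?thesis by (intro I[where as = "[]"]) (simp add: simps)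
  next
    case (Sig_tl a l)
    then show ?thesis by (intro I[where as = "[a, l]"]) (simp add: simps)
  next
    case (Arity a l)
    then show ?thesis by (intro I[where as = "[a, l]"]) (simp add: simps)
  next
    case Rules
    then show ?thesis by (intro I[where as = "[]"]) (simp add: simps)
  next
    case (Rules_tl a l)
    then show ?thesis by (intro I[where as = "[a, l]"]) (simp add: simps)
  next
    case (Look_0 t s)
    then show ?thesis by (intro I[where as = "[t, s]"]) (simp add: simps)
  next
    case (Look_Suc s i t u)
    then show ?thesis by (intro I[where as = "[s, i, t, u]"]) (simp add: simps)
  next
    case (Steps_Var y)
    then show ?thesis by (intro I[where as = "[y]"]) (simp add: simps)
  next
    case (Inst_Var s i t)
    then show ?thesis by (intro I[where as = "[s, i, t]"]) (simp add: simps)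
  next
    case (Vars_Var y l)
    then show ?thesis by (intro I[where as = "[y, l]"]) (simp add: simps)
  next
    case (Rels_Nil m)
    then show ?thesis by (intro I[where as = "[m]"]) (simp add: simps)
  next
    case (Rels_Cons m s t n ss ts)
    then show ?thesis by (intro I[where as = "[m, s, t, n, ss, ts]"]) (simp add: simps)
  next
    case (Rel_Fun m n ss ts f)
    then show ?thesis by (intro I[where as = "[m, n, ss, ts, f]"]) (simp add: simps)
  next
    case (Steps_trans s t u)
    then show ?thesis by (intro I[where as = "[s, t, u]"]) (simp add: simps)
  next
    case (Redex l r b q s)
    then show ?thesis by (intro I[where as = "[l, r, b, q, s]"]) (simp add: simps)
  next
    case (Steps_root q r s t)
    then show ?thesis by (intro I[where as = "[q, r, s, t]"]) (simp add: simps)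
  next
    case (Var y)
    then show ?thesis by (intro I[where as = "[y]"]) (simp add: simps)
  next
    case (Var_Fun y ts f)
    then show ?thesis by (intro I[where as = "[y, ts, f]"]) (simp add: simps)
  next
    case (Vars_hd y t ts)
    then show ?thesis by (intro I[where as = "[y, t, ts]"]) (simp add: simps)
  next
    case (Vars_tl y ts t)
    then show ?thesis by (intro I[where as = "[y, ts, t]"]) (simp add: simps)
  next
    case (Rule f ts r)
    then show ?thesis by (intro I[where as = "[f, ts, r]"]) (simp add: simps)
  next
    case Trs_Nil
    then show ?thesis by (intro I[where as = "[]"]) (simp add: simps)
  next
    case (Trs_Cons l r rs)
    then show ?thesis by (intro I[where as = "[l, r, rs]"]) (simp add: simps)
  qed
qed

section \<open>Soundness and completeness of the judgements\<close>

definition sig_of :: "nat \<Rightarrow> (nat \<times> nat) set" where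
  "sig_of x = {(f, n). prod_encode (f, n) \<in> set (list_decode (pfst x))}"

text \<open>Meaningful for every number: entries that are no codes of two terms are ignored here,
  and \<open>jTrs\<close> checks separately that there are none.\<close>

definition rules_of :: "nat \<Rightarrow> (term \<times> term) set" where
  "rules_of x = {(l, r). prod_encode (enc_term l, enc_term r) \<in> set (list_decode (psnd x))}"

definition dec_term :: "nat \<Rightarrow> term" where
  "dec_term = inv enc_term"

lemma dec_enc_term [simp]: "dec_term (enc_term t) = t"
  unfolding dec_term_def by (rule inv_f_f) (simp add: inj_def)

definition good_rule :: "nat \<Rightarrow> nat \<Rightarrow> nat \<Rightarrow> bool" where
  "good_rule x l r \<longleftrightarrow> (\<exists>l' r'. l = enc_term l' \<and> r = enc_term r' \<and> wf_term (sig_of x) l' \<and>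
     wf_term (sig_of x) r' \<and> (\<forall>y. l' \<noteq> Var y) \<and> vars r' \<subseteq> vars l')"

definition steps_sem :: "nat \<Rightarrow> nat \<Rightarrow> nat \<Rightarrow> bool" where
  "steps_sem x s t \<longleftrightarrow> (\<exists>s' t'. s = enc_term s' \<and> t = enc_term t' \<and> wf_term (sig_of x) s' \<and>
     wf_term (sig_of x) t' \<and> rsteps (rules_of x) s' t')"

definition inst_sem :: "nat \<Rightarrow> nat \<Rightarrow> nat \<Rightarrow> nat \<Rightarrow> bool" where
  "inst_sem x \<sigma> s t \<longleftrightarrow> (\<exists>s' t'. s = enc_term s' \<and> t = enc_term t' \<and> wf_term (sig_of x) s' \<and>
     wf_term (sig_of x) t' \<and> t' = subst (\<lambda>i. dec_term (list_decode \<sigma> ! i)) s')"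

text \<open>The inclusion is vacuous if \<open>l\<close> codes no term, since the rules for
  \<open>jVar\<close> do not check their argument. In \<open>Rule\<close> the other premise supplies
  the term coded by \<open>l\<close>.\<close>

definition vars_sem :: "nat \<Rightarrow> nat \<Rightarrow> nat \<Rightarrow> nat \<Rightarrow> bool" where
  "vars_sem x l s t \<longleftrightarrow> s = t \<and> (\<exists>s'. s = enc_term s' \<and> wf_term (sig_of x) s' \<and>
     (\<forall>l'. l = enc_term l' \<longrightarrow> vars s' \<subseteq> vars l'))"

definition rel_sem :: "nat \<Rightarrow> nat \<Rightarrow> nat \<Rightarrow> nat \<Rightarrow> bool" where
  "rel_sem x m s t \<longleftrightarrow> (m = steps_mode \<longrightarrow> steps_sem x s t) \<and>
     (\<forall>\<sigma>. m = inst_mode \<sigma> \<longrightarrow> inst_sem x \<sigma> s t) \<and> (\<forall>l. m = vars_mode l \<longrightarrow> vars_sem x l s t)"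

lemma rel_sem_simps [simp]:
  "rel_sem x steps_mode = steps_sem x"
  "rel_sem x (inst_mode \<sigma>) = inst_sem x \<sigma>"
  "rel_sem x (vars_mode l) = vars_sem x l"
  by (simp_all add: fun_eq_iff rel_sem_def prod_encode_eq)

text \<open>Judgements are bare numbers, so there is one implication per tag, and a number with no
  such tag holds vacuously. The tags start at 2; this covers the trivial judgement \<open>0\<close>,
  which is the pair of \<open>0\<close> and \<open>0\<close>.\<close>

definition sem :: "nat \<Rightarrow> nat \<Rightarrow> bool" where
  "sem x j \<longleftrightarrow>
     (\<forall>l. j = jSig l \<longrightarrow> set (list_decode l) \<subseteq> set (list_decode (pfst x))) \<and>
     (\<forall>a. j = jArity a \<longrightarrow> a \<in> set (list_decode (pfst x))) \<and>
     (\<forall>l. j = jRules l \<longrightarrow> set (list_decode l) \<subseteq> set (list_decode (psnd x))) \<and>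
     (\<forall>\<sigma> i t. j = jLook \<sigma> i t \<longrightarrow> list_decode \<sigma> ! i = t \<and> (\<exists>t'. t = enc_term t' \<and> wf_term (sig_of x) t')) \<and>
     (\<forall>m s t. j = jRel m s t \<longrightarrow> rel_sem x m s t) \<and>
     (\<forall>m n ss ts. j = jRels m n ss ts \<longrightarrow>
        length (list_decode ss) = n \<and> list_all2 (rel_sem x m) (list_decode ss) (list_decode ts)) \<and>
     (\<forall>y t. j = jVar y t \<longrightarrow> (\<forall>t'. t = enc_term t' \<longrightarrow> y \<in> vars t')) \<and>
     (\<forall>y ts. j = jVars y ts \<longrightarrow> (\<forall>ts'. ts = list_encode (map enc_term ts') \<longrightarrow> (\<exists>t \<in> set ts'. y \<in> vars t))) \<and>
     (\<forall>\<sigma> r s. j = jRedex \<sigma> r s \<longrightarrow> (\<exists>l. prod_encode (l, r) \<in> set (list_decode (psnd x)) \<and> inst_sem x \<sigma> l s)) \<and>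
     (\<forall>l r. j = jRule l r \<longrightarrow> good_rule x l r) \<and>
     (\<forall>rs. j = jTrs rs \<longrightarrow> (\<forall>q \<in> set (list_decode rs). \<exists>l r. q = prod_encode (l, r) \<and> good_rule x l r))"

lemma sem_simps [simp]:
  "sem x (jSig l) \<longleftrightarrow> set (list_decode l) \<subseteq> set (list_decode (pfst x))"
  "sem x (jArity a) \<longleftrightarrow> a \<in> set (list_decode (pfst x))"
  "sem x (jRules l) \<longleftrightarrow> set (list_decode l) \<subseteq> set (list_decode (psnd x))"
  "sem x (jLook \<sigma> i t) \<longleftrightarrow> list_decode \<sigma> ! i = t \<and> (\<exists>t'. t = enc_term t' \<and> wf_term (sig_of x) t')"
  "sem x (jRel m s t) \<longleftrightarrow> rel_sem x m s t"
  "sem x (jRels m n ss ts) \<longleftrightarrow>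
     length (list_decode ss) = n \<and> list_all2 (rel_sem x m) (list_decode ss) (list_decode ts)"
  "sem x (jVar y t) \<longleftrightarrow> (\<forall>t'. t = enc_term t' \<longrightarrow> y \<in> vars t')"
  "sem x (jVars y ts) \<longleftrightarrow> (\<forall>ts'. ts = list_encode (map enc_term ts') \<longrightarrow> (\<exists>t \<in> set ts'. y \<in> vars t))"
  "sem x (jRedex \<sigma> r s) \<longleftrightarrow> (\<exists>l. prod_encode (l, r) \<in> set (list_decode (psnd x)) \<and> inst_sem x \<sigma> l s)"
  "sem x (jRule l r) \<longleftrightarrow> good_rule x l r"
  "sem x (jTrs rs) \<longleftrightarrow> (\<forall>q \<in> set (list_decode rs). \<exists>l r. q = prod_encode (l, r) \<and> good_rule x l r)"
  unfolding sem_def by (simp_all add: prod_encode_eq)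

lemma sem_0: "sem x 0"
proof -
  have "0 = prod_encode (n, d) \<longleftrightarrow> n = 0 \<and> d = 0" for n d
    using prod_encode_eq[of "(0, 0)" "(n, d)"] by (auto simp: prod_encode_def)
  then show ?thesis
    unfolding sem_def by simp
qed

lemma list_all2_ex_map:
  assumes "list_all2 P ss ts" "\<And>s t. P s t \<Longrightarrow> \<exists>s' t'. s = enc_term s' \<and> t = enc_term t' \<and> Q s' t'"
  shows "\<exists>ss' ts'. ss = map enc_term ss' \<and> ts = map enc_term ts' \<and> list_all2 Q ss' ts'"
  using assms(1)
proof (induction rule: list_all2_induct)
  case (Cons s ss t ts)
  then obtain ss' ts' where "ss = map enc_term ss' \<and> ts = map enc_term ts' \<and> list_all2 Q ss' ts'" by blast
  moreover obtain s' t' where "s = enc_term s' \<and> t = enc_term t' \<and> Q s' t'"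
    using assms(2) Cons.hyps by blast
  ultimately have "s # ss = map enc_term (s' # ss') \<and> t # ts = map enc_term (t' # ts') \<and>
      list_all2 Q (s' # ss') (t' # ts')" by simp
  then show ?case by (intro exI)
qed simp

lemma enc_Fun: "enc_term (Fun f ts) = cFun f (list_encode (map enc_term ts))"
  by simp

lemma list_decode_eqD: "list_decode n = xs \<Longrightarrow> n = list_encode xs"
  by auto

lemma steps_sem_Fun:
  assumes "list_all2 (steps_sem x) (list_decode ss) (list_decode ts)" "(f, length (list_decode ss)) \<in> sig_of x"
  shows "steps_sem x (cFun f ss) (cFun f ts)"
proof -
  obtain ss' ts' where st: "list_decode ss = map enc_term ss'" "list_decode ts = map enc_term ts'"
    "list_all2 (\<lambda>s t. wf_term (sig_of x) s \<and> wf_term (sig_of x) t \<and> rsteps (rules_of x) s t) ss' ts'"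
    using list_all2_ex_map[OF assms(1), of "\<lambda>s t. wf_term (sig_of x) s \<and> wf_term (sig_of x) t \<and>
        rsteps (rules_of x) s t"] unfolding steps_sem_def by blast
  then have e: "ss = list_encode (map enc_term ss')" "ts = list_encode (map enc_term ts')"
    by (auto intro: list_decode_eqD)
  have l: "length ts' = length ss'" using st(3) by (auto dest: list_all2_lengthD)
  have "list_all2 (rsteps (rules_of x)) ss' ts'" using st(3) by (auto elim: list_all2_mono)
  moreover have "\<forall>t \<in> set ss'. wf_term (sig_of x) t" "\<forall>t \<in> set ts'. wf_term (sig_of x) t"
    using st(3) by (auto simp: list_all2_conv_all_nth in_set_conv_nth)
  ultimately have "rsteps (rules_of x) (Fun f ss') (Fun f ts') \<and> wf_term (sig_of x) (Fun f ss') \<and>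
      wf_term (sig_of x) (Fun f ts')"
    using assms(2) st(1) l by (auto intro: rsteps_Fun)
  then show ?thesis
    unfolding steps_sem_def e enc_Fun[symmetric] by blast
qed

lemma inst_sem_Fun:
  assumes "list_all2 (inst_sem x \<sigma>) (list_decode ss) (list_decode ts)" "(f, length (list_decode ss)) \<in> sig_of x"
  shows "inst_sem x \<sigma> (cFun f ss) (cFun f ts)"
proof -
  let ?\<sigma> = "\<lambda>i. dec_term (list_decode \<sigma> ! i)"
  obtain ss' ts' where st: "list_decode ss = map enc_term ss'" "list_decode ts = map enc_term ts'"
    "list_all2 (\<lambda>s t. wf_term (sig_of x) s \<and> wf_term (sig_of x) t \<and> t = subst ?\<sigma> s) ss' ts'"
    using list_all2_ex_map[OF assms(1), of "\<lambda>s t. wf_term (sig_of x) s \<and> wf_term (sig_of x) t \<and>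
        t = subst ?\<sigma> s"] unfolding inst_sem_def by blast
  then have e: "ss = list_encode (map enc_term ss')" "ts = list_encode (map enc_term ts')"
    by (auto intro: list_decode_eqD)
  have l: "length ts' = length ss'" using st(3) by (auto dest: list_all2_lengthD)
  have "ts' = map (subst ?\<sigma>) ss'" using st(3) l by (auto simp: list_all2_conv_all_nth list_eq_iff_nth_eq)
  moreover have "\<forall>t \<in> set ss'. wf_term (sig_of x) t" "\<forall>t \<in> set ts'. wf_term (sig_of x) t"
    using st(3) by (auto simp: list_all2_conv_all_nth in_set_conv_nth)
  ultimately have "Fun f ts' = subst ?\<sigma> (Fun f ss') \<and> wf_term (sig_of x) (Fun f ss') \<and>
      wf_term (sig_of x) (Fun f ts')"
    using assms(2) st(1) l by auto
  then show ?thesis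
    unfolding inst_sem_def e enc_Fun[symmetric] by blast
qed

lemma vars_sem_Fun:
  assumes "list_all2 (vars_sem x l) (list_decode ss) (list_decode ts)" "(f, length (list_decode ss)) \<in> sig_of x"
  shows "vars_sem x l (cFun f ss) (cFun f ts)"
proof -
  have "list_decode ss = list_decode ts"
    using assms(1) by (auto simp: list_all2_conv_all_nth list_eq_iff_nth_eq vars_sem_def)
  from arg_cong[OF this, of list_encode] have eq: "ss = ts" by simp
  let ?Q = "\<lambda>s (t :: term). wf_term (sig_of x) s \<and> (\<forall>l'. l = enc_term l' \<longrightarrow> vars s \<subseteq> vars l')"
  have "\<exists>ss' ts'. list_decode ss = map enc_term ss' \<and> list_decode ts = map enc_term ts' \<and> list_all2 ?Q ss' ts'"
    by (rule list_all2_ex_map[OF assms(1)]) (auto simp: vars_sem_def)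
  then obtain ss' ts' where st: "list_decode ss = map enc_term ss'" "list_all2 ?Q ss' ts'"
    by blast
  then have e: "ss = list_encode (map enc_term ss')"
    by (auto intro: list_decode_eqD)
  have "\<forall>t \<in> set ss'. wf_term (sig_of x) t \<and> (\<forall>l'. l = enc_term l' \<longrightarrow> vars t \<subseteq> vars l')"
    using st(2) unfolding list_all2_conv_all_nth by (metis in_set_conv_nth)
  then have "wf_term (sig_of x) (Fun f ss') \<and> (\<forall>l'. l = enc_term l' \<longrightarrow> vars (Fun f ss') \<subseteq> vars l')"
    using assms(2) st(1) by fastforce
  then show ?thesis
    unfolding vars_sem_def eq[symmetric] e enc_Fun[symmetric] by blast
qed

lemma cVar_eq_enc_term: "cVar y = enc_term t \<longleftrightarrow> t = Var y"
  by (cases t) (auto simp: prod_encode_eq)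

lemma cFun_eq_enc_term: "cFun f ts = enc_term t \<longleftrightarrow> (\<exists>ts'. t = Fun f ts' \<and> ts = list_encode (map enc_term ts'))"
  by (cases t) (auto simp: prod_encode_eq)

lemma Suc_eq_list_encode:
  "Suc (prod_encode (t, u)) = list_encode (map enc_term ts) \<longleftrightarrow>
     (\<exists>t' ts'. ts = t' # ts' \<and> t = enc_term t' \<and> u = list_encode (map enc_term ts'))"
  by (cases ts) (auto simp: prod_encode_eq)

lemma sem_jrule:
  assumes "jrule x a b c" "sem x a" "sem x b"
  shows "sem x c"
  using assms(1)
proof cases
  case (Look_0 t \<sigma>)
  then show ?thesis using assms(2) by (auto simp: steps_sem_def)
next
  case (Steps_Var y)
  have "steps_sem x (cVar y) (cVar y)"
    unfolding steps_sem_def by (intro exI[of _ "Var y"]) simp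
  with Steps_Var show ?thesis by simp
next
  case (Inst_Var \<sigma> i t)
  with assms(2) obtain t' where "list_decode \<sigma> ! i = enc_term t'" "t = enc_term t'" "wf_term (sig_of x) t'"
    by auto
  then have "inst_sem x \<sigma> (cVar i) t"
    unfolding inst_sem_def by (intro exI[of _ "Var i"] exI[of _ t']) simp
  with Inst_Var show ?thesis by simp
next
  case (Vars_Var y l)
  with assms(2) have "vars_sem x l (cVar y) (cVar y)"
    unfolding vars_sem_def by (auto intro!: exI[of _ "Var y"])
  with Vars_Var show ?thesis by simp
next
  case (Rel_Fun m n ss ts f)
  have l: "list_all2 (rel_sem x m) (list_decode ss) (list_decode ts)" "(f, length (list_decode ss)) \<in> sig_of x"
    using assms(2,3) Rel_Fun by (auto simp: sig_of_def)
  have "rel_sem x m (cFun f ss) (cFun f ts)"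
    unfolding rel_sem_def[of x m "cFun f ss"]
  proof (intro conjI allI impI)
    show "steps_sem x (cFun f ss) (cFun f ts)" if "m = steps_mode"
      using l unfolding that rel_sem_simps by (rule steps_sem_Fun)
    show "inst_sem x \<sigma> (cFun f ss) (cFun f ts)" if "m = inst_mode \<sigma>" for \<sigma>
      using l unfolding that rel_sem_simps by (rule inst_sem_Fun)
    show "vars_sem x k (cFun f ss) (cFun f ts)" if "m = vars_mode k" for k
      using l unfolding that rel_sem_simps by (rule vars_sem_Fun)
  qed
  with Rel_Fun show ?thesis by simp
next
  case (Steps_trans s t u)
  then have "steps_sem x s t" "steps_sem x t u"
    using assms(2,3) by simp_all
  then have "steps_sem x s u"
    unfolding steps_sem_def using rsteps_trans by (metis enc_term_inject)
  with Steps_trans show ?thesis by simp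
next
  case (Steps_root \<sigma> r s t)
  then obtain l where l: "prod_encode (l, r) \<in> set (list_decode (psnd x))" "inst_sem x \<sigma> l s" "inst_sem x \<sigma> r t"
    using assms(2,3) by auto
  let ?\<sigma> = "\<lambda>i. dec_term (list_decode \<sigma> ! i)"
  obtain l' r' where lr: "l = enc_term l'" "s = enc_term (subst ?\<sigma> l')" "r = enc_term r'" "t = enc_term (subst ?\<sigma> r')"
    "wf_term (sig_of x) (subst ?\<sigma> l')" "wf_term (sig_of x) (subst ?\<sigma> r')"
    using l(2,3) unfolding inst_sem_def by auto
  have "(l', r') \<in> rules_of x" using l(1) lr by (simp add: rules_of_def)
  then have "rsteps (rules_of x) (subst ?\<sigma> l') (subst ?\<sigma> r')"
    unfolding rsteps_def by (intro r_into_rtranclp rstep.root)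
  then have "steps_sem x s t" using lr unfolding steps_sem_def by blast
  with Steps_root show ?thesis by simp
next
  case (Var y)
  then show ?thesis by (simp add: cVar_eq_enc_term)
next
  case (Var_Fun y ts f)
  then show ?thesis using assms(2) by (auto simp: cFun_eq_enc_term)
next
  case (Vars_hd y t ts)
  then show ?thesis using assms(2) by (auto simp: Suc_eq_list_encode)
next
  case (Vars_tl y ts t)
  then show ?thesis using assms(2) by (auto simp: Suc_eq_list_encode)
next
  case (Rule f ts r)
  then have s: "steps_sem x (cFun f ts) (cFun f ts)" "vars_sem x (cFun f ts) r r"
    using assms(2,3) by simp_all
  then obtain l' where "cFun f ts = enc_term l'" "wf_term (sig_of x) l'"
    unfolding steps_sem_def by blast
  moreover from this obtain r' where "r = enc_term r'" "wf_term (sig_of x) r'" "vars r' \<subseteq> vars l'"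
    using s(2) unfolding vars_sem_def by blast
  moreover have "\<forall>y. l' \<noteq> Var y"
    using \<open>cFun f ts = enc_term l'\<close> by (auto simp: prod_encode_eq)
  ultimately have "good_rule x (cFun f ts) r"
    unfolding good_rule_def by blast
  with Rule show ?thesis by simp
qed (use assms(2,3) in auto)

lemma derives_sound: "derives x j \<Longrightarrow> sem x j"
proof (induction rule: derivable.induct)
  case trivial
  show ?case by (rule sem_0)
next
  case (schema A B C v)
  show ?case
    by (rule sem_jrule[OF judgement_schemas_jrule[OF schema(1)] schema.IH])
qed

section \<open>Completeness: true judgements are derivable\<close>

lemmas derives_0 = derivable.trivial[of judgement_schemas]

lemma derives_Arity:
  assumes "derives x (jSig (list_encode l))" "a \<in> set l"
  shows "derives x (jArity a)"
  using assms
proof (induction l)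
  case (Cons b l)
  then have d: "derives x (jSig (Suc (pr b (list_encode l))))" by simp
  from Cons.IH Cons.prems(2) derives_jrule[OF jrule.Arity d derives_0] derives_jrule[OF jrule.Sig_tl d derives_0]
  show ?case by auto
qed simp

lemma derives_sig: "(f, n) \<in> sig_of x \<Longrightarrow> derives x (jArity (pr f n))"
  using derives_Arity[of x "list_decode (pfst x)" "pr f n"] derives_jrule[OF jrule.Sig derives_0 derives_0]
  by (simp add: sig_of_def)

lemma derives_Rules:
  assumes "derives x (jRules (list_encode l))" "a \<in> set l"
  shows "\<exists>b. derives x (jRules (Suc (pr a b)))"
  using assms
proof (induction l)
  case (Cons b l)
  then have d: "derives x (jRules (Suc (pr b (list_encode l))))" by simp
  from Cons.IH Cons.prems(2) d derives_jrule[OF jrule.Rules_tl d derives_0]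
  show ?case by auto
qed simp

lemma derives_rules: "(l, r) \<in> rules_of x \<Longrightarrow> \<exists>b. derives x (jRules (Suc (pr (pr (enc_term l) (enc_term r)) b)))"
  using derives_Rules[of x "list_decode (psnd x)" "pr (enc_term l) (enc_term r)"]
    derives_jrule[OF jrule.Rules derives_0 derives_0]
  by (simp add: rules_of_def)

text \<open>Uniform in the mode \<open>m\<close>: sharing this congruence argument is the purpose of
  treating three relations as one judgement \<open>jRel\<close>.\<close>

lemma derives_Rel_Fun:
  assumes "list_all2 (\<lambda>s t. derives x (jRel m (enc_term s) (enc_term t))) ss ts" "(f, length ss) \<in> sig_of x"
  shows "derives x (jRel m (enc_term (Fun f ss)) (enc_term (Fun f ts)))"
proof -
  have "derives x (jRels m (length ss) (list_encode (map enc_term ss)) (list_encode (map enc_term ts)))"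
    using assms(1)
  proof (induction rule: list_all2_induct)
    case Nil
    show ?case using derives_jrule[OF jrule.Rels_Nil derives_0 derives_0] by simp
  next
    case (Cons s ss t ts)
    from derives_jrule[OF jrule.Rels_Cons Cons.hyps(1) Cons.IH] show ?case by simp
  qed
  from derives_jrule[OF jrule.Rel_Fun this derives_sig[OF assms(2)]] show ?thesis
    by simp
qed

lemma derives_refl: "wf_term (sig_of x) t \<Longrightarrow> derives x (jRel steps_mode (enc_term t) (enc_term t))"
proof (induction t)
  case (Var y)
  show ?case using derives_jrule[OF jrule.Steps_Var derives_0 derives_0] by simp
next
  case (Fun f ts)
  then show ?case
    by (intro derives_Rel_Fun) (auto simp: list_all2_same)
qed

lemma derives_Look:
  "i < length ts \<Longrightarrow> wf_term (sig_of x) (ts ! i) \<Longrightarrow>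
    derives x (jLook (list_encode (map enc_term ts)) i (enc_term (ts ! i)))"
proof (induction ts arbitrary: i)
  case (Cons t ts)
  show ?case
  proof (cases i)
    case 0
    with Cons.prems derives_jrule[OF jrule.Look_0 derives_refl derives_0] show ?thesis by simp
  next
    case (Suc j)
    with Cons.prems have "derives x (jLook (list_encode (map enc_term ts)) j (enc_term (ts ! j)))"
      by (intro Cons.IH) auto
    from derives_jrule[OF jrule.Look_Suc this derives_0] Suc show ?thesis by simp
  qed
qed simp

lemma derives_Inst:
  assumes "wf_term (sig_of x) s" "\<And>y. y \<in> vars s \<Longrightarrow> y < length ts \<and> wf_term (sig_of x) (ts ! y)"
  shows "derives x (jRel (inst_mode (list_encode (map enc_term ts))) (enc_term s) (enc_term (subst (nth ts) s)))"
  using assms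
proof (induction s)
  case (Var y)
  then have "derives x (jLook (list_encode (map enc_term ts)) y (enc_term (ts ! y)))"
    by (intro derives_Look) simp_all
  from derives_jrule[OF jrule.Inst_Var this derives_0] show ?case by simp
next
  case (Fun f ss)
  have "list_all2 (\<lambda>s t. derives x (jRel (inst_mode (list_encode (map enc_term ts))) (enc_term s) (enc_term t)))
      ss (map (subst (nth ts)) ss)"
    unfolding list_all2_conv_all_nth
  proof (intro conjI allI impI)
    fix i assume i: "i < length ss"
    have "wf_term (sig_of x) (ss ! i)" using Fun.prems(1) i by simp
    moreover have "y < length ts \<and> wf_term (sig_of x) (ts ! y)" if "y \<in> vars (ss ! i)" for y
      using Fun.prems(2)[of y] that i by fastforce
    ultimately show "derives x (jRel (inst_mode (list_encode (map enc_term ts))) (enc_term (ss ! i))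
        (enc_term (map (subst (nth ts)) ss ! i)))"
      using Fun.IH[of "ss ! i"] i by simp
  qed simp
  from derives_Rel_Fun[OF this] Fun.prems(1) show ?case by simp
qed

lemma finite_vars: "finite (vars t)"
  by (induction t) auto

lemma wf_subst: "wf_term \<Sigma> (subst \<sigma> t) \<longleftrightarrow> wf_term \<Sigma> t \<and> (\<forall>y \<in> vars t. wf_term \<Sigma> (\<sigma> y))"
  by (induction t) auto

lemma derives_rstep:
  assumes trs: "is_trs (sig_of x) (rules_of x)" and step: "rstep (rules_of x) s t" and wf: "wf_term (sig_of x) s"
  shows "derives x (jRel steps_mode (enc_term s) (enc_term t)) \<and> wf_term (sig_of x) t"
  using step wf
proof (induction rule: rstep.induct)
  case (root l r \<sigma>)
  then have lr: "wf_term (sig_of x) l" "wf_term (sig_of x) r" "vars r \<subseteq> vars l"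
    using trs unfolding is_trs_def by auto
  \<comment> \<open>A derivation can only mention a finite substitution, so \<open>\<sigma>\<close>
    is cut down to a list covering the variables of \<open>l\<close>, hence those of
    \<open>r\<close>. Its other entries may be ill-formed: a lookup checks only the entry that it
    returns.\<close>
  obtain n where n: "\<And>y. y \<in> vars l \<Longrightarrow> y < n"
    using finite_vars[of l] unfolding finite_nat_set_iff_bounded by blast
  define ts where "ts = map \<sigma> [0..<n]"
  have ts: "y < length ts \<and> ts ! y = \<sigma> y \<and> wf_term (sig_of x) (ts ! y)" if "y \<in> vars l" for y
    using n[OF that] that root.prems by (simp add: ts_def wf_subst)
  have eq: "subst (nth ts) l = subst \<sigma> l" "subst (nth ts) r = subst \<sigma> r"
    using ts lr(3) by (auto intro!: subst_cong)
  obtain b where b: "derives x (jRules (Suc (pr (pr (enc_term l) (enc_term r)) b)))"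
    using derives_rules[OF root.hyps] by blast
  have "derives x (jRel (inst_mode (list_encode (map enc_term ts))) (enc_term l) (enc_term (subst \<sigma> l)))"
    using derives_Inst[OF lr(1), of ts] ts unfolding eq by blast
  from derives_jrule[OF jrule.Redex b this]
  have redex: "derives x (jRedex (list_encode (map enc_term ts)) (enc_term r) (enc_term (subst \<sigma> l)))" .
  have "derives x (jRel (inst_mode (list_encode (map enc_term ts))) (enc_term r) (enc_term (subst \<sigma> r)))"
    using derives_Inst[OF lr(2), of ts] ts lr(3) unfolding eq by blast
  from derives_jrule[OF jrule.Steps_root redex this]
  show ?case using root.prems lr by (auto simp: wf_subst)
next
  case (ctxt s t i ts f)
  have wf_args: "(f, length ts) \<in> sig_of x" "\<And>j. j < length ts \<Longrightarrow> wf_term (sig_of x) (ts[i := s] ! j)"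
    using ctxt.prems by (auto simp del: nth_list_update)
  have "wf_term (sig_of x) s" using wf_args(2)[OF ctxt.hyps(2)] ctxt.hyps(2) by simp
  note st = ctxt.IH[OF this]
  have "derives x (jRel steps_mode (enc_term (ts[i := s] ! j)) (enc_term (ts[i := t] ! j))) \<and>
      wf_term (sig_of x) (ts[i := t] ! j)" if "j < length ts" for j
    using st wf_args(2)[OF that] derives_refl that by (cases "j = i") auto
  then show ?case
    using wf_args(1) by (auto simp: list_all2_conv_all_nth in_set_conv_nth intro!: derives_Rel_Fun
        simp del: enc_term.simps nth_list_update)
qed

lemma derives_rsteps:
  assumes trs: "is_trs (sig_of x) (rules_of x)" and steps: "rsteps (rules_of x) s t" and wf: "wf_term (sig_of x) s"
  shows "derives x (jRel steps_mode (enc_term s) (enc_term t)) \<and> wf_term (sig_of x) t"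
  using steps unfolding rsteps_def
proof (induction rule: rtranclp_induct)
  case base
  show ?case using wf derives_refl by simp
next
  case (step t u)
  then have "derives x (jRel steps_mode (enc_term t) (enc_term u)) \<and> wf_term (sig_of x) u"
    using derives_rstep[OF trs] by blast
  with step.IH derives_jrule[OF jrule.Steps_trans] show ?case by blast
qed

lemma derives_Var: "y \<in> vars t \<Longrightarrow> derives x (jVar y (enc_term t))"
proof (induction t)
  case (Var z)
  then show ?case using derives_jrule[OF jrule.Var derives_0 derives_0] by simp
next
  case (Fun f ts)
  have "derives x (jVars y (list_encode (map enc_term us)))"
    if "\<exists>u \<in> set us. derives x (jVar y (enc_term u))" for us
    using that
  proof (induction us)
    case (Cons u us)
    then show ?case
      using derives_jrule[OF jrule.Vars_hd _ derives_0, of x y "enc_term u" "list_encode (map enc_term us)"]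
        derives_jrule[OF jrule.Vars_tl _ derives_0, of x y "list_encode (map enc_term us)" "enc_term u"]
      by auto
  qed simp
  moreover have "\<exists>u \<in> set ts. derives x (jVar y (enc_term u))" using Fun by auto
  ultimately have "derives x (jVars y (list_encode (map enc_term ts)))" by blast
  from derives_jrule[OF jrule.Var_Fun this derives_0] show ?case by simp
qed

lemma derives_vars:
  "wf_term (sig_of x) t \<Longrightarrow> vars t \<subseteq> vars l \<Longrightarrow> derives x (jRel (vars_mode (enc_term l)) (enc_term t) (enc_term t))"
proof (induction t)
  case (Var y)
  then have "derives x (jVar y (enc_term l))" by (simp add: derives_Var)
  from derives_jrule[OF jrule.Vars_Var this derives_0] show ?case by simp
next
  case (Fun f ts)
  have "derives x (jRel (vars_mode (enc_term l)) (enc_term t) (enc_term t))" if "t \<in> set ts" for t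
    using Fun.IH[OF that] Fun.prems that by auto
  then show ?case
    using Fun.prems by (intro derives_Rel_Fun) (auto simp: list_all2_same)
qed

lemma derives_Trs:
  assumes "\<forall>(l, r) \<in> set rs. wf_term (sig_of x) l \<and> wf_term (sig_of x) r \<and> (\<forall>y. l \<noteq> Var y) \<and> vars r \<subseteq> vars l"
  shows "derives x (jTrs (list_encode (map (\<lambda>(l, r). prod_encode (enc_term l, enc_term r)) rs)))"
  using assms
proof (induction rs)
  case Nil
  show ?case using derives_jrule[OF jrule.Trs_Nil derives_0 derives_0] by simp
next
  case (Cons q rs)
  obtain l r where q: "q = (l, r)" by (cases q)
  with Cons.prems have lr: "wf_term (sig_of x) l" "wf_term (sig_of x) r" "\<forall>y. l \<noteq> Var y" "vars r \<subseteq> vars l" by auto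
  from lr(3) obtain f ts where l: "l = Fun f ts" by (cases l) auto
  have "derives x (jRule (enc_term l) (enc_term r))"
    using derives_jrule[OF jrule.Rule, of x f "list_encode (map enc_term ts)" "enc_term r"]
      derives_refl[OF lr(1)] derives_vars[OF lr(2,4)] by (simp add: l)
  moreover have "derives x (jTrs (list_encode (map (\<lambda>(l, r). prod_encode (enc_term l, enc_term r)) rs)))"
    using Cons by simp
  ultimately show ?case
    using derives_jrule[OF jrule.Trs_Cons] by (simp add: q)
qed

section \<open>Recognising codes of rewrite systems\<close>

lemma sig_of_enc_trs [simp]: "sig_of (enc_trs sig rs) = set sig"
proof -
  have "prod_encode ` set sig = {p. prod_decode p \<in> set sig}"
    by (auto simp: image_iff) (metis prod_decode_inverse)
  then show ?thesis
    by (auto simp: sig_of_def enc_trs_def)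
qed

lemma rules_of_enc_trs [simp]: "rules_of (enc_trs sig rs) = set rs"
  by (auto simp: rules_of_def enc_trs_def prod_encode_eq image_iff split: prod.splits)

text \<open>Only the rules call for a judgement: every number decodes to a list of pairs and so to a
  signature, but not every number codes a term.\<close>

lemma derives_Trs_iff:
  "derives x (jTrs (psnd x)) \<longleftrightarrow> (\<exists>sig rs. x = enc_trs sig rs \<and> is_trs (set sig) (set rs))"
proof
  assume "derives x (jTrs (psnd x))"
  then have good: "\<forall>q \<in> set (list_decode (psnd x)). \<exists>l r. q = prod_encode (l, r) \<and> good_rule x l r"
    using derives_sound by fastforce
  define sig where "sig = map prod_decode (list_decode (pfst x))"
  define rs where "rs = map (\<lambda>q. (dec_term (pfst q), dec_term (psnd q))) (list_decode (psnd x))"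
  have "map (\<lambda>(l, r). prod_encode (enc_term l, enc_term r)) rs = list_decode (psnd x)"
    unfolding rs_def map_map
  proof (rule map_idI)
    fix q assume "q \<in> set (list_decode (psnd x))"
    with good obtain l r where "q = prod_encode (enc_term l, enc_term r)"
      unfolding good_rule_def by blast
    then show "((\<lambda>(l, r). prod_encode (enc_term l, enc_term r)) \<circ> (\<lambda>q. (dec_term (pfst q), dec_term (psnd q)))) q = q"
      by simp
  qed
  then have x: "x = enc_trs sig rs"
    by (simp add: enc_trs_def sig_def o_def)
  have "wf_term (set sig) l \<and> wf_term (set sig) r \<and> (\<forall>y. l \<noteq> Var y) \<and> vars r \<subseteq> vars l"
    if "(l, r) \<in> set rs" for l r
  proof -
    have "prod_encode (enc_term l, enc_term r) \<in> set (list_decode (psnd x))"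
      using that rules_of_enc_trs[of sig rs] x[symmetric] by (auto simp: rules_of_def)
    with good have "good_rule x (enc_term l) (enc_term r)"
      by (auto simp: prod_encode_eq)
    then show ?thesis
      using sig_of_enc_trs[of sig rs] x[symmetric] by (simp add: good_rule_def)
  qed
  then have "is_trs (set sig) (set rs)" unfolding is_trs_def by auto
  with x show "\<exists>sig rs. x = enc_trs sig rs \<and> is_trs (set sig) (set rs)" by blast
next
  assume "\<exists>sig rs. x = enc_trs sig rs \<and> is_trs (set sig) (set rs)"
  then obtain sig rs where x: "x = enc_trs sig rs" "is_trs (set sig) (set rs)" by blast
  have "derives x (jTrs (list_encode (map (\<lambda>(l, r). prod_encode (enc_term l, enc_term r)) rs)))"
    by (rule derives_Trs) (use x in \<open>auto simp: is_trs_def\<close>)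
  then show "derives x (jTrs (psnd x))"
    by (simp add: x(1) enc_trs_def)
qed

section \<open>The abstract machine\<close>

text \<open>Symbols below 16 are constructors of data: numerals, lists, programs and, with prefix
  \<open>k\<close>, continuations. Symbols from 16 on control the machine. Keeping the stack of
  pending work in a continuation is what allows rules with a control symbol at the root
  only.\<close>

abbreviation "tZero \<equiv> Fun 2 []"
abbreviation "tSuc t \<equiv> Fun 3 [t]"
abbreviation "tNil \<equiv> Fun 4 []"
abbreviation "tCons t u \<equiv> Fun 5 [t, u]"
abbreviation "cZero \<equiv> Fun 6 []"
abbreviation "cSucc \<equiv> Fun 7 []"
abbreviation "cProj i \<equiv> Fun 8 [i]"
abbreviation "cComp f gs \<equiv> Fun 9 [f, gs]"
abbreviation "cPrim f g \<equiv> Fun 10 [f, g]"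
abbreviation "cMn f \<equiv> Fun 11 [f]"
abbreviation "kSearch z y \<equiv> Fun 12 [z, y]"
abbreviation "kComp gs xs acc f k \<equiv> Fun 13 [gs, xs, acc, f, k]"
abbreviation "kPrim g n xs k \<equiv> Fun 14 [g, n, xs, k]"
abbreviation "kMn f n xs k \<equiv> Fun 15 [f, n, xs, k]"
abbreviation "mAccept \<equiv> Fun 16 []"
abbreviation "mStart y \<equiv> Fun 17 [y]"
abbreviation "mScan u w \<equiv> Fun 18 [u, w]"
abbreviation "mSearch z y \<equiv> Fun 19 [z, y]"
abbreviation "mEval f xs k \<equiv> Fun 20 [f, xs, k]"
abbreviation "mReturn v k \<equiv> Fun 21 [v, k]"
abbreviation "mLookup i xs k \<equiv> Fun 22 [i, xs, k]"
abbreviation "mArgs gs xs acc f k \<equiv> Fun 23 [gs, xs, acc, f, k]"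
abbreviation "mMin f n xs k \<equiv> Fun 24 [f, n, xs, k]"

definition machine_signature :: "(nat \<times> nat) list" where
  "machine_signature = [(2, 0), (3, 1), (4, 0), (5, 2), (6, 0), (7, 0), (8, 1), (9, 2), (10, 2), (11, 1),
     (12, 2), (13, 5), (14, 4), (15, 4), (16, 0), (17, 1), (18, 2), (19, 2), (20, 3), (21, 2), (22, 3), (23, 5), (24, 4)]"

definition fixed_rules :: "(term \<times> term) list" where
  "fixed_rules = (let a = Var 0; b = Var 1; c = Var 2; d = Var 3; e = Var 4; f = Var 5 in
    [(mStart a, mAccept),
     (mStart a, mScan tZero a),
     (mScan tZero a, mStart a),
     (mScan a (tSuc b), mScan (tSuc a) b),
     (mScan (tSuc a) b, mScan a (tSuc b)),
     (mScan a tZero, mSearch tZero a),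
     (mReturn tZero (kSearch a b), mSearch (tSuc a) b),
     (mReturn (tSuc a) (kSearch b c), mAccept),
     (mEval cZero a b, mReturn tZero b),
     (mEval cSucc (tCons a b) c, mReturn (tSuc a) c),
     (mEval (cProj a) b c, mLookup a b c),
     (mLookup tZero (tCons a b) c, mReturn a c),
     (mLookup (tSuc a) (tCons b c) d, mLookup a c d),
     (mEval (cComp a b) c d, mArgs b c tNil a d),
     (mArgs tNil a b c d, mEval c b d),
     (mArgs (tCons a b) c d e f, mEval a c (kComp b c d e f)),
     (mReturn a (kComp b c d e f), mArgs b c (tCons a d) e f),
     (mEval (cPrim a b) (tCons tZero c) d, mEval a c d),
     (mEval (cPrim a b) (tCons (tSuc c) d) e, mEval (cPrim a b) (tCons c d) (kPrim b c d e)),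
     (mReturn a (kPrim b c d e), mEval b (tCons a (tCons c d)) e),
     (mEval (cMn a) b c, mMin a tZero b c),
     (mMin a b c d, mEval a (tCons b c) (kMn a b c d)),
     (mReturn tZero (kMn a b c d), mReturn b d),
     (mReturn (tSuc a) (kMn b c d e), mMin b (tSuc c) d e)])"

text \<open>The added rule alone depends on the instance. It runs the program \<open>c\<close> on
  the candidate, the scanned number and \<open>x\<close>, while \<open>kSearch\<close> remembers
  candidate and number in case of failure.\<close>

definition machine_rules :: "term \<Rightarrow> term \<Rightarrow> (term \<times> term) list" where
  "machine_rules c x = (mSearch (Var 0) (Var 1),
       mEval c (tCons (Var 0) (tCons (Var 1) (tCons x tNil))) (kSearch (Var 0) (Var 1))) # fixed_rules"

text \<open>Root steps with the matching already carried out, so that case analysis yields arbitrary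
  terms in place of substitutions.\<close>

inductive mstep :: "term \<Rightarrow> term \<Rightarrow> term \<Rightarrow> term \<Rightarrow> bool" for p x where
  Start_Accept: "mstep p x (mStart y) mAccept"
| Start_Scan: "mstep p x (mStart y) (mScan tZero y)"
| Scan_Start: "mstep p x (mScan tZero y) (mStart y)"
| Scan_right: "mstep p x (mScan u (tSuc w)) (mScan (tSuc u) w)"
| Scan_left: "mstep p x (mScan (tSuc u) w) (mScan u (tSuc w))"
| Scan_Search: "mstep p x (mScan u tZero) (mSearch tZero u)"
| Search: "mstep p x (mSearch z y) (mEval p (tCons z (tCons y (tCons x tNil))) (kSearch z y))"
| Search_zero: "mstep p x (mReturn tZero (kSearch z y)) (mSearch (tSuc z) y)"
| Search_Suc: "mstep p x (mReturn (tSuc v) (kSearch z y)) mAccept"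
| Zero: "mstep p x (mEval cZero xs k) (mReturn tZero k)"
| Succ: "mstep p x (mEval cSucc (tCons n xs) k) (mReturn (tSuc n) k)"
| Proj: "mstep p x (mEval (cProj i) xs k) (mLookup i xs k)"
| Lookup_zero: "mstep p x (mLookup tZero (tCons n xs) k) (mReturn n k)"
| Lookup_Suc: "mstep p x (mLookup (tSuc i) (tCons n xs) k) (mLookup i xs k)"
| Comp: "mstep p x (mEval (cComp f gs) xs k) (mArgs gs xs tNil f k)"
| Args_Nil: "mstep p x (mArgs tNil xs acc f k) (mEval f acc k)"
| Args_Cons: "mstep p x (mArgs (tCons g gs) xs acc f k) (mEval g xs (kComp gs xs acc f k))"
| Args_Return: "mstep p x (mReturn v (kComp gs xs acc f k)) (mArgs gs xs (tCons v acc) f k)"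
| Prim_zero: "mstep p x (mEval (cPrim f g) (tCons tZero xs) k) (mEval f xs k)"
| Prim_Suc: "mstep p x (mEval (cPrim f g) (tCons (tSuc n) xs) k) (mEval (cPrim f g) (tCons n xs) (kPrim g n xs k))"
| Prim_Return: "mstep p x (mReturn v (kPrim g n xs k)) (mEval g (tCons v (tCons n xs)) k)"
| Mn: "mstep p x (mEval (cMn f) xs k) (mMin f tZero xs k)"
| Min: "mstep p x (mMin f n xs k) (mEval f (tCons n xs) (kMn f n xs k))"
| Min_zero: "mstep p x (mReturn tZero (kMn f n xs k)) (mReturn n k)"
| Min_Suc: "mstep p x (mReturn (tSuc v) (kMn f n xs k)) (mMin f (tSuc n) xs k)"

lemma subst_ground: "vars t = {} \<Longrightarrow> subst \<sigma> t = t"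
  by (induction t) (auto simp: map_idI)

lemma root_step_machine_iff:
  assumes "vars p = {}" "vars x = {}"
  shows "root_step (set (machine_rules p x)) s t \<longleftrightarrow> mstep p x s t"
proof
  assume "root_step (set (machine_rules p x)) s t"
  then show "mstep p x s t"
    unfolding root_step_def machine_rules_def fixed_rules_def Let_def
    by (auto simp: subst_ground assms intro: mstep.intros)
next
  have I: "root_step (set (machine_rules p x)) s t"
    if "\<exists>(l, r) \<in> set (machine_rules p x). s = subst (nth ts) l \<and> t = subst (nth ts) r" for s t ts
    using that unfolding root_step_def by blast
  note rules = machine_rules_def fixed_rules_def Let_def subst_ground assms
  assume "mstep p x s t"
  then show "root_step (set (machine_rules p x)) s t"
  proof cases
    case (Start_Accept y)
    then show ?thesis by (intro I[where ts = "[y]"]) (simp add: rules)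
  next
    case (Start_Scan y)
    then show ?thesis by (intro I[where ts = "[y]"]) (simp add: rules)
  next
    case (Scan_Start y)
    then show ?thesis by (intro I[where ts = "[y]"]) (simp add: rules)
  next
    case (Scan_right u w)
    then show ?thesis by (intro I[where ts = "[u, w]"]) (simp add: rules)
  next
    case (Scan_left u w)
    then show ?thesis by (intro I[where ts = "[u, w]"]) (simp add: rules)
  next
    case (Scan_Search u)
    then show ?thesis by (intro I[where ts = "[u]"]) (simp add: rules)
  next
    case (Search z y)
    then show ?thesis by (intro I[where ts = "[z, y]"]) (simp add: rules)
  next
    case (Search_zero z y)
    then show ?thesis by (intro I[where ts = "[z, y]"]) (simp add: rules)
  next
    case (Search_Suc v z y)
    then show ?thesis by (intro I[where ts = "[v, z, y]"]) (simp add: rules)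
  next
    case (Zero xs k)
    then show ?thesis by (intro I[where ts = "[xs, k]"]) (simp add: rules)
  next
    case (Succ n xs k)
    then show ?thesis by (intro I[where ts = "[n, xs, k]"]) (simp add: rules)
  next
    case (Proj i xs k)
    then show ?thesis by (intro I[where ts = "[i, xs, k]"]) (simp add: rules)
  next
    case (Lookup_zero n xs k)
    then show ?thesis by (intro I[where ts = "[n, xs, k]"]) (simp add: rules)
  next
    case (Lookup_Suc i n xs k)
    then show ?thesis by (intro I[where ts = "[i, n, xs, k]"]) (simp add: rules)
  next
    case (Comp f gs xs k)
    then show ?thesis by (intro I[where ts = "[f, gs, xs, k]"]) (simp add: rules)
  next
    case (Args_Nil xs acc f k)
    then show ?thesis by (intro I[where ts = "[xs, acc, f, k]"]) (simp add: rules)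
  next
    case (Args_Cons g gs xs acc f k)
    then show ?thesis by (intro I[where ts = "[g, gs, xs, acc, f, k]"]) (simp add: rules)
  next
    case (Args_Return v gs xs acc f k)
    then show ?thesis by (intro I[where ts = "[v, gs, xs, acc, f, k]"]) (simp add: rules)
  next
    case (Prim_zero f g xs k)
    then show ?thesis by (intro I[where ts = "[f, g, xs, k]"]) (simp add: rules)
  next
    case (Prim_Suc f g n xs k)
    then show ?thesis by (intro I[where ts = "[f, g, n, xs, k]"]) (simp add: rules)
  next
    case (Prim_Return v g n xs k)
    then show ?thesis by (intro I[where ts = "[v, g, n, xs, k]"]) (simp add: rules)
  next
    case (Mn f xs k)
    then show ?thesis by (intro I[where ts = "[f, xs, k]"]) (simp add: rules)
  next
    case (Min f n xs k)
    then show ?thesis by (intro I[where ts = "[f, n, xs, k]"]) (simp add: rules)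
  next
    case (Min_zero f n xs k)
    then show ?thesis by (intro I[where ts = "[f, n, xs, k]"]) (simp add: rules)
  next
    case (Min_Suc v f n xs k)
    then show ?thesis by (intro I[where ts = "[v, f, n, xs, k]"]) (simp add: rules)
  qed
qed


section \<open>Simulation of recursive functions by the machine\<close>

fun tlist :: "term list \<Rightarrow> term" where
  "tlist [] = tNil"
| "tlist (t # ts) = tCons t (tlist ts)"

text \<open>The base \<open>t\<close> is arbitrary, because the scan also meets terms such as
  \<open>sucs n (Var i)\<close>.\<close>

definition sucs :: "nat \<Rightarrow> term \<Rightarrow> term" where
  "sucs n t = ((\<lambda>t. tSuc t) ^^ n) t"

lemma sucs_0 [simp]: "sucs 0 t = t"
  and sucs_Suc [simp]: "sucs (Suc n) t = tSuc (sucs n t)"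
  by (simp_all add: sucs_def)

abbreviation num :: "nat \<Rightarrow> term" where
  "num n \<equiv> sucs n tZero"

abbreviation nums :: "nat list \<Rightarrow> term" where
  "nums xs \<equiv> tlist (map num xs)"

text \<open>The argument functions of a composition are stored in reverse, so that evaluating them from the
  last to the first and pushing the values yields the argument list in the right order.\<close>

fun code :: "recf \<Rightarrow> term" where
  "code Zero = cZero"
| "code Succ = cSucc"
| "code (Proj i) = cProj (num i)"
| "code (Comp f gs) = cComp (code f) (tlist (rev (map code gs)))"
| "code (Prim f g) = cPrim (code f) (code g)"
| "code (Mn f) = cMn (code f)"

lemma step_rtranclp: "mstep p x a b \<Longrightarrow> (mstep p x)\<^sup>*\<^sup>* b c \<Longrightarrow> (mstep p x)\<^sup>*\<^sup>* a c"
  by (rule converse_rtranclp_into_rtranclp)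

lemma lookup_sim:
  "i < length xs \<Longrightarrow> (mstep p x)\<^sup>*\<^sup>* (mLookup (num i) (tlist xs) k) (mReturn (xs ! i) k)"
proof (induction xs arbitrary: i)
  case (Cons a xs)
  show ?case
  proof (cases i)
    case 0
    then show ?thesis by (auto intro: mstep.Lookup_zero)
  next
    case (Suc j)
    then have "mstep p x (mLookup (num i) (tlist (a # xs)) k) (mLookup (num j) (tlist xs) k)"
      by (auto intro: mstep.Lookup_Suc)
    with Cons Suc show ?thesis by (auto intro: step_rtranclp)
  qed
qed simp

lemma args_sim:
  assumes "list_all2 (\<lambda>g y. \<forall>k. (mstep p x)\<^sup>*\<^sup>* (mEval (code g) xs k) (mReturn (num y) k)) gs ys"
  shows "(mstep p x)\<^sup>*\<^sup>* (mArgs (tlist (map code gs)) xs (tlist acc) f k)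
    (mArgs tNil xs (tlist (rev (map num ys) @ acc)) f k)"
  using assms
proof (induction gs ys arbitrary: acc rule: list_all2_induct)
  case (Cons g gs y ys)
  let ?k = "kComp (tlist (map code gs)) xs (tlist acc) f k"
  have "mstep p x (mArgs (tlist (map code (g # gs))) xs (tlist acc) f k) (mEval (code g) xs ?k)"
    by (auto intro: mstep.Args_Cons)
  moreover have "(mstep p x)\<^sup>*\<^sup>* (mEval (code g) xs ?k) (mReturn (num y) ?k)"
    using Cons.hyps by blast
  moreover have "mstep p x (mReturn (num y) ?k) (mArgs (tlist (map code gs)) xs (tlist (num y # acc)) f k)"
    by (auto intro: mstep.Args_Return)
  moreover note Cons.IH[of "num y # acc"]
  ultimately show ?case
    by (simp del: tlist.simps)
qed simp

text \<open>The continuation varies in the induction, as subcomputations run under additional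
  frames. For a total predicate this one direction fixes the outcome of the run, by
  determinism.\<close>

lemma eval_sim:
  "eval f xs y \<Longrightarrow> (mstep p x)\<^sup>*\<^sup>* (mEval (code f) (nums xs) k) (mReturn (num y) k)"
proof (induction arbitrary: k rule: eval.induct)
  case (eval_Zero xs)
  show ?case by (auto intro: mstep.Zero)
next
  case (eval_Succ n xs)
  show ?case by (auto intro: mstep.Succ)
next
  case (eval_Proj i xs)
  then have "(mstep p x)\<^sup>*\<^sup>* (mLookup (num i) (nums xs) k) (mReturn (num (xs ! i)) k)"
    using lookup_sim[of i "map num xs" p x k] by simp
  then show ?case by (auto intro: step_rtranclp[OF mstep.Proj])
next
  case (eval_Comp xs gs ys f z)
  have "list_all2 (\<lambda>g y. \<forall>k. (mstep p x)\<^sup>*\<^sup>* (mEval (code g) (nums xs) k) (mReturn (num y) k)) (rev gs) (rev ys)"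
    using eval_Comp.IH(1) by (auto elim: list_all2_mono)
  from args_sim[OF this, of "[]" "code f" k]
  have "(mstep p x)\<^sup>*\<^sup>* (mArgs (tlist (rev (map code gs))) (nums xs) tNil (code f) k)
      (mArgs tNil (nums xs) (nums ys) (code f) k)"
    by (simp add: rev_map)
  moreover have "(mstep p x)\<^sup>*\<^sup>* (mArgs tNil (nums xs) (nums ys) (code f) k) (mReturn (num z) k)"
    using eval_Comp.IH(2) by (rule step_rtranclp[OF mstep.Args_Nil])
  ultimately show ?case
    by (auto intro!: step_rtranclp[OF mstep.Comp])
next
  case (eval_Prim0 f xs y g)
  then show ?case by (auto intro: step_rtranclp[OF mstep.Prim_zero])
next
  case (eval_PrimS f g n xs y z)
  let ?k = "kPrim (code g) (num n) (nums xs) k"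
  have "(mstep p x)\<^sup>*\<^sup>* (mEval (code g) (tCons (num y) (tCons (num n) (nums xs))) k) (mReturn (num z) k)"
    using eval_PrimS.IH(2) by simp
  then have "(mstep p x)\<^sup>*\<^sup>* (mReturn (num y) ?k) (mReturn (num z) k)"
    by (rule step_rtranclp[OF mstep.Prim_Return])
  moreover have "(mstep p x)\<^sup>*\<^sup>* (mEval (cPrim (code f) (code g)) (tCons (num n) (nums xs)) ?k) (mReturn (num y) ?k)"
    using eval_PrimS.IH(1) by simp
  ultimately show ?case
    by (auto intro!: step_rtranclp[OF mstep.Prim_Suc])
next
  case (eval_Mn f n xs)
  have step: "(mstep p x)\<^sup>*\<^sup>* (mMin (code f) (num m) (nums xs) k) (mReturn (num v) (kMn (code f) (num m) (nums xs) k))"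
    if "\<And>k. (mstep p x)\<^sup>*\<^sup>* (mEval (code f) (nums (m # xs)) k) (mReturn (num v) k)" for m v
    using that[of "kMn (code f) (num m) (nums xs) k"] by (auto intro: step_rtranclp[OF mstep.Min])
  have "(mstep p x)\<^sup>*\<^sup>* (mMin (code f) tZero (nums xs) k) (mMin (code f) (num m) (nums xs) k)" if "m \<le> n" for m
    using that
  proof (induction m)
    case (Suc m)
    then obtain v where "\<And>k. (mstep p x)\<^sup>*\<^sup>* (mEval (code f) (nums (m # xs)) k) (mReturn (num (Suc v)) k)"
      using eval_Mn.IH(2) by (meson Suc_le_lessD)
    note step[OF this]
    also have "mstep p x (mReturn (num (Suc v)) (kMn (code f) (num m) (nums xs) k))
        (mMin (code f) (num (Suc m)) (nums xs) k)"
      by (auto intro: mstep.Min_Suc)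
    finally show ?case using Suc by auto
  qed simp
  from this[of n] have "(mstep p x)\<^sup>*\<^sup>* (mMin (code f) tZero (nums xs) k) (mMin (code f) (num n) (nums xs) k)"
    by simp
  also note step[OF eval_Mn.IH(1)]
  also have "mstep p x (mReturn (num 0) (kMn (code f) (num n) (nums xs) k)) (mReturn (num n) k)"
    by (auto intro: mstep.Min_zero)
  finally show ?case
    by (auto intro: step_rtranclp[OF mstep.Mn])
qed

section \<open>Confluence of the abstract machine\<close>

definition control_symbols :: "nat set" where
  "control_symbols = {16..}"

definition closed_data :: "term \<Rightarrow> bool" where
  "closed_data t \<longleftrightarrow> vars t = {} \<and> funs t \<inter> control_symbols = {} \<and> wf_term (set machine_signature) t"

lemma closed_data_sucs [simp]: "closed_data (sucs n t) \<longleftrightarrow> closed_data t"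
  by (induction n) (auto simp: closed_data_def control_symbols_def machine_signature_def)

lemma closed_data_tlist [simp]: "closed_data (tlist ts) \<longleftrightarrow> (\<forall>t \<in> set ts. closed_data t)"
  by (induction ts) (auto simp: closed_data_def control_symbols_def machine_signature_def)

lemma closed_data_tZero [simp]: "closed_data tZero"
  by (auto simp: closed_data_def control_symbols_def machine_signature_def)

lemma closed_data_code: "closed_data (code f)"
proof (induction f)
  case (Proj i)
  have "closed_data (num i)" by simp
  then show ?case
    by (auto simp: closed_data_def control_symbols_def machine_signature_def simp del: closed_data_sucs)
next
  case (Comp f gs)
  then have "closed_data (tlist (rev (map code gs)))" by simp
  with Comp(1) show ?case
    by (auto simp: closed_data_def control_symbols_def machine_signature_def simp del: closed_data_tlist)
qed (auto simp: closed_data_def control_symbols_def machine_signature_def)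

lemma flat_trs_machine:
  assumes "closed_data p" "closed_data x"
  shows "flat_trs (set (machine_rules p x)) control_symbols"
proof
  have c: "vars p = {}" "vars x = {}" "funs p \<inter> control_symbols = {}" "funs x \<inter> control_symbols = {}"
    using assms by (auto simp: closed_data_def)
  have v: "vars_list p = []" "vars_list x = []"
    using c by (simp_all flip: set_empty add: set_vars_list)
  fix l r assume lr: "(l, r) \<in> set (machine_rules p x)"
  show "\<exists>f ps g qs. l = Fun f ps \<and> r = Fun g qs \<and> f \<in> control_symbols \<and> g \<in> control_symbols \<and>
      (\<forall>p \<in> set ps. funs p \<inter> control_symbols = {}) \<and> (\<forall>q \<in> set qs. funs q \<inter> control_symbols = {})"
    using lr c unfolding machine_rules_def fixed_rules_def Let_def
    by (auto simp: control_symbols_def)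
  show "distinct (vars_list l)"
    using lr unfolding machine_rules_def fixed_rules_def Let_def by auto
  show "vars r \<subseteq> vars l"
    using lr c unfolding machine_rules_def fixed_rules_def Let_def by auto
qed

lemma is_trs_machine:
  assumes "closed_data p" "closed_data x"
  shows "is_trs (set machine_signature) (set (machine_rules p x))"
proof -
  have "wf_term (set machine_signature) l \<and> wf_term (set machine_signature) r \<and> (\<forall>y. l \<noteq> Var y) \<and> vars r \<subseteq> vars l"
    if "(l, r) \<in> set (machine_rules p x)" for l r
  proof -
    have "wf_term (set machine_signature) p" "wf_term (set machine_signature) x" "vars p = {}" "vars x = {}"
      using assms by (auto simp: closed_data_def)
    with that show ?thesis
      unfolding machine_rules_def fixed_rules_def Let_def
      by (auto simp: machine_signature_def)
  qed
  then show ?thesis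
    unfolding is_trs_def by auto
qed

definition deterministic_config :: "term \<Rightarrow> bool" where
  "deterministic_config t \<longleftrightarrow> (\<forall>y. t \<noteq> mStart y) \<and> (\<forall>u w. t \<noteq> mScan u w)"

text \<open>Apart from \<open>mStart\<close> and \<open>mScan\<close>, the control symbol and the
  constructors in its arguments select at most one rule.\<close>

lemma mstep_deterministic:
  assumes "mstep p x s t" "mstep p x s u" "deterministic_config s"
  shows "t = u"
  using assms by (cases rule: mstep.cases) (auto simp: deterministic_config_def elim: mstep.cases)

lemma mstep_deterministic_config:
  "mstep p x s t \<Longrightarrow> deterministic_config s \<Longrightarrow> deterministic_config t"
  by (cases rule: mstep.cases) (auto simp: deterministic_config_def)

text \<open>A run without branching is a path, and two points on a path are comparable. Termination
  plays no part in this.\<close>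

lemma msteps_linear:
  assumes "(mstep p x)\<^sup>*\<^sup>* s t" "(mstep p x)\<^sup>*\<^sup>* s u" "deterministic_config s"
  shows "(mstep p x)\<^sup>*\<^sup>* t u \<or> (mstep p x)\<^sup>*\<^sup>* u t"
proof -
  have det: "deterministic_config v" if "(mstep p x)\<^sup>*\<^sup>* s v" for v
    using that by (induction rule: rtranclp_induct) (auto intro: mstep_deterministic_config assms(3))
  show ?thesis
    using assms(1)
  proof (induction rule: rtranclp_induct)
    case base
    then show ?case using assms(2) by simp
  next
    case (step t v)
    from step.IH show ?case
    proof
      assume "(mstep p x)\<^sup>*\<^sup>* t u"
      then show ?thesis
      proof (cases rule: converse_rtranclpE)
        case base
        with step(2) show ?thesis by auto
      next
        case (step w)
        with mstep_deterministic[OF \<open>mstep p x t v\<close> _ det[OF \<open>(mstep p x)\<^sup>*\<^sup>* s t\<close>]]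
        show ?thesis by auto
      qed
    next
      assume "(mstep p x)\<^sup>*\<^sup>* u t"
      from rtranclp.rtrancl_into_rtrancl[OF this step(2)] show ?thesis by blast
    qed
  qed
qed

lemma no_mstep_Accept: "\<not> mstep p x mAccept t"
  by (auto elim: mstep.cases)

lemma msteps_Accept: "(mstep p x)\<^sup>*\<^sup>* mAccept t \<Longrightarrow> t = mAccept"
  using no_mstep_Accept by (metis converse_rtranclpE)

lemma msteps_reach_Accept:
  assumes "(mstep p x)\<^sup>*\<^sup>* s mAccept" "(mstep p x)\<^sup>*\<^sup>* s t" "deterministic_config s"
  shows "(mstep p x)\<^sup>*\<^sup>* t mAccept"
  using msteps_linear[OF assms] msteps_Accept by blast

lemma sucs_decomposition: "\<exists>n u. t = sucs n u \<and> (\<forall>w. u \<noteq> tSuc w)"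
proof (induction t)
  case (Var x)
  have "Var x = sucs 0 (Var x) \<and> (\<forall>w. Var x \<noteq> tSuc w)" by simp
  then show ?case by blast
next
  case (Fun f ts)
  show ?case
  proof (cases "\<exists>w. Fun f ts = tSuc w")
    case True
    then obtain w where w: "f = 3" "ts = [w]" by auto
    with Fun obtain n u where "w = sucs n u" "\<forall>w. u \<noteq> tSuc w" by auto
    with w have "Fun f ts = sucs (Suc n) u \<and> (\<forall>w. u \<noteq> tSuc w)" by simp
    then show ?thesis by blast
  next
    case False
    then have "Fun f ts = sucs 0 (Fun f ts) \<and> (\<forall>w. Fun f ts \<noteq> tSuc w)" by simp
    then show ?thesis by blast
  qed
qed

lemma sucs_eq_tSuc: "sucs i u = tSuc w \<Longrightarrow> \<forall>w. u \<noteq> tSuc w \<Longrightarrow> \<exists>j. i = Suc j \<and> w = sucs j u"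
  by (cases i) auto

lemma sucs_eq_tZero: "sucs i u = tZero \<Longrightarrow> i = 0 \<and> u = tZero"
  by (cases i) auto

text \<open>The configurations reachable from one another by the reversible moves between \<open>mStart\<close> and \<open>mScan\<close>.
  A class can be left to \<open>mAccept\<close> only if \<open>u\<close> is zero, and to \<open>mSearch\<close> only if \<open>w\<close> is zero: both exits
  exist exactly when the scanned argument is a genuine numeral.\<close>

definition scan_class :: "term \<Rightarrow> nat \<Rightarrow> term \<Rightarrow> term set" where
  "scan_class u n w = {mScan (sucs i u) (sucs j w) | i j. i + j = n} \<union>
     (if u = tZero then {mStart (sucs n w)} else {})"

lemma scan_class_cover:
  assumes "\<not> deterministic_config t"
  shows "\<exists>u n w. t \<in> scan_class u n w \<and> (\<forall>v. u \<noteq> tSuc v) \<and> (\<forall>v. w \<noteq> tSuc v)"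
proof (cases "\<exists>y. t = mStart y")
  case True
  then obtain y where "t = mStart y" by blast
  moreover obtain n w where "y = sucs n w" "\<forall>v. w \<noteq> tSuc v"
    using sucs_decomposition by blast
  ultimately have "t \<in> scan_class tZero n w \<and> (\<forall>v. tZero \<noteq> tSuc v) \<and> (\<forall>v. w \<noteq> tSuc v)"
    by (simp add: scan_class_def)
  then show ?thesis by blast
next
  case False
  then obtain a b where t: "t = mScan a b"
    using assms by (auto simp: deterministic_config_def)
  obtain i u where u: "a = sucs i u" "\<forall>v. u \<noteq> tSuc v"
    using sucs_decomposition by blast
  obtain j w where w: "b = sucs j w" "\<forall>v. w \<noteq> tSuc v"
    using sucs_decomposition by blast
  have "t \<in> scan_class u (i + j) w \<and> (\<forall>v. u \<noteq> tSuc v) \<and> (\<forall>v. w \<noteq> tSuc v)"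
    using t u w by (auto simp: scan_class_def)
  then show ?thesis by blast
qed

text \<open>Neither base is a successor, so scan moves merely shift one of the \<open>n\<close>
  successors to the other side. The exits ask for a bare \<open>tZero\<close> on one side, which
  forces the base there to be \<open>tZero\<close> with no successors around it.\<close>

lemma scan_class_step:
  assumes t: "t \<in> scan_class u n w" and u: "\<forall>v. u \<noteq> tSuc v" and w: "\<forall>v. w \<noteq> tSuc v"
    and step: "mstep p x t t'"
  shows "t' \<in> scan_class u n w \<or> t' = mAccept \<and> u = tZero \<or> t' = mSearch tZero (sucs n u) \<and> w = tZero"
  using step
proof cases
  case (Start_Scan y)
  with t have "u = tZero" "y = sucs n w" by (auto simp: scan_class_def split: if_splits)
  then have "t' = mScan (sucs 0 u) (sucs n w)" using Start_Scan by simp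
  then show ?thesis unfolding scan_class_def by fastforce
next
  case (Scan_Start y)
  with t obtain i j where "tZero = sucs i u" "y = sucs j w" "i + j = n"
    by (auto simp: scan_class_def split: if_splits)
  then show ?thesis using Scan_Start sucs_eq_tZero[of i u] by (auto simp: scan_class_def)
next
  case (Scan_right a b)
  with t obtain i j where ij: "a = sucs i u" "sucs j w = tSuc b" "i + j = n"
    by (auto simp: scan_class_def split: if_splits)
  obtain j' where "j = Suc j'" "b = sucs j' w" using sucs_eq_tSuc[OF ij(2) w] by blast
  then have "t' = mScan (sucs (Suc i) u) (sucs j' w) \<and> Suc i + j' = n" using Scan_right ij by simp
  then show ?thesis unfolding scan_class_def by blast
next
  case (Scan_left a b)
  with t obtain i j where ij: "sucs i u = tSuc a" "b = sucs j w" "i + j = n"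
    by (auto simp: scan_class_def split: if_splits)
  obtain i' where "i = Suc i'" "a = sucs i' u" using sucs_eq_tSuc[OF ij(1) u] by blast
  then have "t' = mScan (sucs i' u) (sucs (Suc j) w) \<and> i' + Suc j = n" using Scan_left ij by simp
  then show ?thesis unfolding scan_class_def by blast
next
  case (Scan_Search a)
  with t obtain i j where ij: "a = sucs i u" "sucs j w = tZero" "i + j = n"
    by (auto simp: scan_class_def split: if_splits)
  then show ?thesis using Scan_Search sucs_eq_tZero[of j w] by auto
qed (use t in \<open>auto simp: scan_class_def split: if_splits\<close>)

lemma scan_left_steps: "(mstep p x)\<^sup>*\<^sup>* (mScan (sucs i u) (sucs j w)) (mScan u (sucs (i + j) w))"
proof (induction i arbitrary: j)
  case (Suc i)
  have "mstep p x (mScan (sucs (Suc i) u) (sucs j w)) (mScan (sucs i u) (sucs (Suc j) w))"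
    by (auto intro: mstep.Scan_left)
  with Suc[of "Suc j"] show ?case by (auto intro: step_rtranclp)
qed simp

lemma scan_right_steps: "(mstep p x)\<^sup>*\<^sup>* (mScan u (sucs (i + j) w)) (mScan (sucs i u) (sucs j w))"
proof (induction i arbitrary: j)
  case (Suc i)
  have "mstep p x (mScan (sucs i u) (sucs (Suc j) w)) (mScan (sucs (Suc i) u) (sucs j w))"
    by (auto intro: mstep.Scan_right)
  with Suc[of "Suc j"] show ?case by auto
qed simp

lemma scan_class_connected:
  assumes "s \<in> scan_class u n w" "t \<in> scan_class u n w"
  shows "(mstep p x)\<^sup>*\<^sup>* s t"
proof -
  \<comment> \<open>The leftmost position serves as hub: every member scans left to it, and any
    other split is reached from it by scanning right.\<close>
  let ?c = "mScan u (sucs n w)"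
  have "(mstep p x)\<^sup>*\<^sup>* s ?c"
    using assms(1) scan_left_steps[of p x] mstep.Start_Scan[of p x]
    by (auto simp: scan_class_def split: if_splits)
  moreover have "(mstep p x)\<^sup>*\<^sup>* ?c t"
    using assms(2) scan_right_steps[of p x u] mstep.Scan_Start[of p x]
    by (auto simp: scan_class_def split: if_splits)
  ultimately show ?thesis by simp
qed

text \<open>Only a branching start needs care, and its class has at most two exits. If
  \<open>u\<close> is zero, every reachable configuration can still reach \<open>mAccept\<close>. If
  only \<open>w\<close> is zero, the search is the sole exit, and all later configurations lie on
  one deterministic run. If neither is zero, the class is never left and all its members reach one
  another.\<close>

theorem confluentp_mstep:
  assumes halts: "\<And>n. (mstep p x)\<^sup>*\<^sup>* (mSearch tZero (num n)) mAccept"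
  shows "confluentp (mstep p x)"
proof (rule confluentpI)
  fix s t1 t2 assume st: "(mstep p x)\<^sup>*\<^sup>* s t1" "(mstep p x)\<^sup>*\<^sup>* s t2"
  show "\<exists>d. (mstep p x)\<^sup>*\<^sup>* t1 d \<and> (mstep p x)\<^sup>*\<^sup>* t2 d"
  proof (cases "deterministic_config s")
    case True
    from msteps_linear[OF st True] show ?thesis by blast
  next
    case False
    then obtain u n w where s: "s \<in> scan_class u n w" and uw: "\<forall>v. u \<noteq> tSuc v" "\<forall>v. w \<noteq> tSuc v"
      using scan_class_cover by blast
    let ?W = "mSearch tZero (sucs n u)"
    have W: "deterministic_config ?W" by (simp add: deterministic_config_def)
    have reach: "t \<in> scan_class u n w \<or> t = mAccept \<and> u = tZero \<or> (mstep p x)\<^sup>*\<^sup>* ?W t \<and> w = tZero"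
      if "(mstep p x)\<^sup>*\<^sup>* s t" for t
      using that
    proof (induction rule: rtranclp_induct)
      case (step t t')
      from step.IH show ?case
      proof (elim disjE)
        assume "t \<in> scan_class u n w"
        from scan_class_step[OF this uw step(2)] show ?thesis by auto
      next
        assume "t = mAccept \<and> u = tZero"
        with step(2) no_mstep_Accept show ?thesis by blast
      next
        assume "(mstep p x)\<^sup>*\<^sup>* ?W t \<and> w = tZero"
        with step(2) show ?thesis by (meson rtranclp.rtrancl_into_rtrancl)
      qed
    qed (use s in simp)
    show ?thesis
    proof (cases "u = tZero")
      case True
      have "(mstep p x)\<^sup>*\<^sup>* t mAccept" if "(mstep p x)\<^sup>*\<^sup>* s t" for t
        using reach[OF that]
      proof (elim disjE)
        assume t: "t \<in> scan_class u n w"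
        have "mStart (sucs n w) \<in> scan_class u n w" using True by (simp add: scan_class_def)
        from scan_class_connected[OF t this, of p x] show ?thesis
          using mstep.Start_Accept by (rule rtranclp.rtrancl_into_rtrancl)
      next
        assume "(mstep p x)\<^sup>*\<^sup>* ?W t \<and> w = tZero"
        \<comment> \<open>As both bases are \<open>tZero\<close> here, \<open>?W\<close> searches
          for the genuine numeral \<open>num n\<close>, which is what \<open>halts\<close> is
          about.\<close>
        then show ?thesis using msteps_reach_Accept[OF _ _ W] halts True by blast
      qed simp
      with st show ?thesis by blast
    next
      case False
      show ?thesis
      proof (cases "w = tZero")
        case True
        have "(mstep p x)\<^sup>*\<^sup>* t ?W" if "t \<in> scan_class u n w" for t
        proof -
          have "mScan (sucs n u) tZero \<in> scan_class u n w"
            using True by (auto simp: scan_class_def intro: exI[of _ n])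
          from scan_class_connected[OF that this, of p x] show ?thesis
            using mstep.Scan_Search by (rule rtranclp.rtrancl_into_rtrancl)
        qed
        then have "(mstep p x)\<^sup>*\<^sup>* t ?W \<or> (mstep p x)\<^sup>*\<^sup>* ?W t" if "(mstep p x)\<^sup>*\<^sup>* s t" for t
          using reach[OF that] False by blast
        \<comment> \<open>The scanned term \<open>sucs n u\<close> is no numeral here, so the search
          may get stuck or diverge; comparability on the run from \<open>?W\<close> is
          enough.\<close>
        with st msteps_linear[OF _ _ W] show ?thesis by (meson rtranclp_trans)
      next
        case w: False
        have "t1 \<in> scan_class u n w" "t2 \<in> scan_class u n w"
          using reach[OF st(1)] reach[OF st(2)] w False by auto
        from scan_class_connected[OF this, of p x] show ?thesis by blast
      qed
    qed
  qed
qed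

section \<open>Hardness\<close>

lemma funs_subst: "funs (subst \<sigma> t) = funs t \<union> (\<Union>x \<in> vars t. funs (\<sigma> x))"
  by (induction t) auto

lemma (in flat_trs) no_rstep_data:
  "rstep R t u \<Longrightarrow> funs t \<inter> F \<noteq> {}"
proof (induction rule: rstep.induct)
  case (root l r \<sigma>)
  from rule_shape[OF root] obtain f ps where "l = Fun f ps" "f \<in> F" by blast
  then show ?case by auto
next
  case (ctxt s t i ts f)
  then have "s \<in> set (ts[i := s])" by (simp add: set_update_memI)
  with ctxt.IH show ?case by auto
qed

definition (in flat_trs) flat_config :: "term \<Rightarrow> bool" where
  "flat_config t \<longleftrightarrow> (\<exists>f ts. t = Fun f ts \<and> (\<forall>u \<in> set ts. funs u \<inter> F = {}))"

text \<open>Redexes need a control symbol and the arguments have none, so only the root can be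
  rewritten; the substituted terms are parts of those arguments and stay free of control symbols.
  Reduction from such a term is therefore exactly a run of the machine.\<close>

lemma (in flat_trs) rstep_flat_config:
  assumes "flat_config t" "rstep R t u"
  shows "root_step R t u \<and> flat_config u"
proof -
  obtain f ts where t: "t = Fun f ts" "\<And>u. u \<in> set ts \<Longrightarrow> funs u \<inter> F = {}"
    using assms(1) by (auto simp: flat_config_def)
  have "\<not> inner_step R t u"
    using no_rstep_data t unfolding inner_step_def by (metis nth_mem term.inject(2))
  then have root: "root_step R t u"
    using assms(2) by (simp add: rstep_iff_root_or_inner)
  then obtain l r \<sigma> where lr: "(l, r) \<in> R" "t = subst \<sigma> l" "u = subst \<sigma> r"
    unfolding root_step_def by blast
  from rule_shape[OF lr(1)] obtain g ps h qs where sh: "l = Fun g ps" "r = Fun h qs"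
    "\<And>q. q \<in> set qs \<Longrightarrow> funs q \<inter> F = {}"
    by blast
  have "funs (\<sigma> x) \<inter> F = {}" if x: "x \<in> vars l" for x
  proof -
    obtain p where p: "p \<in> set ps" "x \<in> vars p" using x sh(1) by auto
    have "subst \<sigma> p \<in> set ts"
      using p t(1) lr(2) sh(1) by auto
    then have "funs (subst \<sigma> p) \<inter> F = {}" by (rule t(2))
    with p(2) show ?thesis by (auto simp: funs_subst)
  qed
  then have "funs (subst \<sigma> q) \<inter> F = {}" if "q \<in> set qs" for q
    using sh(3)[OF that] vars_rule[OF lr(1)] that sh(2) by (fastforce simp: funs_subst)
  then have "flat_config u"
    by (auto simp: flat_config_def lr(3) sh(2))
  with root show ?thesis ..
qed

lemma search_steps:
  assumes "eval r [z, y, x] v"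
  shows "(mstep (code r) (num x))\<^sup>+\<^sup>+ (mSearch (num z) (num y)) (mReturn (num v) (kSearch (num z) (num y)))"
  using eval_sim[OF assms, of "code r" "num x" "kSearch (num z) (num y)"]
  by (intro rtranclp_into_tranclp2[of "mstep (code r) (num x)", OF mstep.Search]) simp

context
  fixes r :: recf and P :: "nat \<Rightarrow> nat \<Rightarrow> nat \<Rightarrow> bool"
  assumes r: "\<And>x y z. eval r [z, y, x] (if P x y z then 1 else 0)"
begin

lemma search_success:
  assumes "P x y z"
  shows "(mstep (code r) (num x))\<^sup>*\<^sup>* (mSearch (num z) (num y)) mAccept"
proof -
  have "(mstep (code r) (num x))\<^sup>+\<^sup>+ (mSearch (num z) (num y)) (mReturn (num 1) (kSearch (num z) (num y)))"
    using search_steps[of r z y x 1] r[of z y x] assms by simp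
  moreover have "mstep (code r) (num x) (mReturn (num 1) (kSearch (num z) (num y))) mAccept"
    by (auto intro: mstep.Search_Suc)
  ultimately show ?thesis
    by (meson tranclp.trancl_into_trancl tranclp_into_rtranclp)
qed

lemma search_failure:
  assumes "\<not> P x y z"
  shows "(mstep (code r) (num x))\<^sup>+\<^sup>+ (mSearch (num z) (num y)) (mSearch (num (Suc z)) (num y))"
proof -
  have "(mstep (code r) (num x))\<^sup>+\<^sup>+ (mSearch (num z) (num y)) (mReturn tZero (kSearch (num z) (num y)))"
    using search_steps[of r z y x 0] r[of z y x] assms by simp
  moreover have "mstep (code r) (num x) (mReturn tZero (kSearch (num z) (num y))) (mSearch (num (Suc z)) (num y))"
    by (auto intro: mstep.Search_zero)
  ultimately show ?thesis
    by (rule tranclp.trancl_into_trancl)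
qed

text \<open>Induction on the distance \<open>n\<close> from the current candidate to a witness; an
  earlier witness just ends the search sooner.\<close>

lemma search_halts:
  "P x y (z + n) \<Longrightarrow> (mstep (code r) (num x))\<^sup>*\<^sup>* (mSearch (num z) (num y)) mAccept"
proof (induction n arbitrary: z)
  case 0
  then show ?case using search_success by simp
next
  case (Suc n)
  show ?case
  proof (cases "P x y z")
    case True
    then show ?thesis by (rule search_success)
  next
    case False
    then show ?thesis
      using search_failure[OF False] Suc.IH[of "Suc z"] Suc.prems
      by (simp add: tranclp_rtranclp_tranclp tranclp_into_rtranclp)
  qed
qed

lemma closed_data_params: "closed_data (code r)" "closed_data (num x)"
  by (simp_all add: closed_data_code)

lemma root_step_params: "root_step (set (machine_rules (code r) (num x))) = mstep (code r) (num x)"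
  using root_step_machine_iff[of "code r" "num x"] closed_data_params(1) closed_data_params(2)[of x]
  by (intro ext) (simp add: closed_data_def)

lemma machine_confluent:
  assumes "\<forall>y. \<exists>z. P x y z"
  shows "confluent_on (set (machine_rules (code r) (num x))) t"
proof -
  interpret flat_trs "set (machine_rules (code r) (num x))" control_symbols
    by (rule flat_trs_machine[OF closed_data_params])
  have "(mstep (code r) (num x))\<^sup>*\<^sup>* (mSearch tZero (num y)) mAccept" for y
    using assms search_halts[of x y 0] by (metis add_0 sucs_0)
  then show ?thesis
    by (intro confluent_if_root_confluent) (simp add: root_step_params confluentp_mstep)
qed

text \<open>The start configuration accepts at once, but can also scan the numeral to its end and
  commit to a search that runs for ever and never meets the normal form
  \<open>mAccept\<close>.\<close>

lemma machine_not_confluent: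
  assumes y: "\<forall>z. \<not> P x y z"
  shows "\<not> confluent_on (set (machine_rules (code r) (num x))) (mStart (num y))"
proof
  let ?R = "set (machine_rules (code r) (num x))"
  let ?m = "mstep (code r) (num x)"
  assume conf: "confluent_on ?R (mStart (num y))"
  interpret flat_trs ?R control_symbols
    by (rule flat_trs_machine[OF closed_data_params])
  \<comment> \<open>Configurations whose run still visits some candidate of the search. Determinism
    keeps every step on that run, and since all candidates fail, a later one is always
    ahead.\<close>
  define Z where "Z = {t. flat_config t \<and> deterministic_config t \<and> (\<exists>z. ?m\<^sup>*\<^sup>* t (mSearch (num z) (num y)))}"
  have Z_step: "u \<in> Z" if "t \<in> Z" "rstep ?R t u" for t u
  proof -
    from that(1) obtain z where t: "flat_config t" "deterministic_config t" "?m\<^sup>*\<^sup>* t (mSearch (num z) (num y))"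
      by (auto simp: Z_def)
    have u: "?m t u" "flat_config u"
      using rstep_flat_config[OF t(1) that(2)] by (simp_all add: root_step_params)
    \<comment> \<open>The candidate \<open>z\<close> may be \<open>t\<close> itself. Going on to
      \<open>Suc z\<close> makes the run nonempty, so its first step must be the one to
      \<open>u\<close>.\<close>
    have "?m\<^sup>+\<^sup>+ t (mSearch (num (Suc z)) (num y))"
      using t(3) search_failure y by (meson rtranclp_tranclp_tranclp)
    then obtain u' where "?m t u'" "?m\<^sup>*\<^sup>* u' (mSearch (num (Suc z)) (num y))"
      by (meson tranclpD)
    with mstep_deterministic[OF u(1) _ t(2)] have "?m\<^sup>*\<^sup>* u (mSearch (num (Suc z)) (num y))"
      by blast
    with u mstep_deterministic_config[OF u(1) t(2)] show ?thesis
      unfolding Z_def by blast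
  qed
  have "closed_data tZero" "closed_data (num y)" by simp_all
  then have "flat_config (mSearch tZero (num y))"
    by (simp add: flat_config_def closed_data_def del: closed_data_sucs closed_data_tZero)
  moreover have "\<exists>z. ?m\<^sup>*\<^sup>* (mSearch tZero (num y)) (mSearch (num z) (num y))"
    by (rule exI[of _ 0]) simp
  ultimately have "mSearch tZero (num y) \<in> Z"
    by (simp add: Z_def deterministic_config_def)
  moreover have "t \<in> Z" if "rsteps ?R s t" "s \<in> Z" for s t
    using that unfolding rsteps_def by (induction rule: rtranclp_induct) (auto intro: Z_step)
  moreover have "mAccept \<notin> Z"
  proof
    assume "mAccept \<in> Z"
    then obtain z where "?m\<^sup>*\<^sup>* mAccept (mSearch (num z) (num y))" by (auto simp: Z_def)
    from msteps_Accept[OF this] show False by simp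
  qed
  ultimately have no_Accept: "\<not> rsteps ?R (mSearch tZero (num y)) mAccept" by blast
  have "?m\<^sup>*\<^sup>* (mStart (num y)) (mScan tZero (sucs (y + 0) tZero))"
    by (auto intro: mstep.Start_Scan)
  also have "?m\<^sup>*\<^sup>* (mScan tZero (sucs (y + 0) tZero)) (mScan (num y) tZero)"
    using scan_right_steps[of "code r" "num x" tZero y 0 tZero] by simp
  also have "?m (mScan (num y) tZero) (mSearch tZero (num y))"
    by (rule mstep.Scan_Search)
  finally have "rsteps ?R (mStart (num y)) (mSearch tZero (num y))"
    by (intro root_steps_imp_rsteps) (simp add: root_step_params)
  moreover have "rsteps ?R (mStart (num y)) mAccept"
    by (intro root_steps_imp_rsteps) (auto simp: root_step_params intro: mstep.Start_Accept)
  ultimately obtain d where d: "rsteps ?R (mSearch tZero (num y)) d" "rsteps ?R mAccept d"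
    using conf unfolding confluent_on_def by blast
  have "\<not> rstep ?R mAccept u" for u
    using no_mstep_Accept[of "code r" "num x" u] rstep_flat_config[of mAccept u]
    by (auto simp: root_step_params flat_config_def)
  with d(2) have "d = mAccept"
    unfolding rsteps_def by (metis converse_rtranclpE)
  with d(1) no_Accept show False by simp
qed

end

section \<open>Computability of the reduction\<close>

lemma computable_enc_num: "total_computable (\<lambda>x. enc_term (num x))"
proof -
  \<comment> \<open>\<open>?F\<close> sends the code of \<open>t\<close> to the code of
    \<open>tSuc t\<close>: tag 1, symbol 3, and the one-element argument list.\<close>
  let ?F = "\<lambda>m. prod_encode (1, prod_encode (3, Suc (prod_encode (m, 0))))"
  have "enc_term (num x) = (?F ^^ x) (enc_term tZero)" for x
    by (induction x) simp_all
  moreover have "total_computable (\<lambda>x. (?F ^^ x) (enc_term tZero))"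
    by (intro computable_iter computable_pair computable_Suc computable_const computable_id)
  ultimately show ?thesis by simp
qed

lemma computable_machine: "total_computable (\<lambda>x. enc_trs machine_signature (machine_rules c (num x)))"
proof -
  have "(\<lambda>x. enc_trs machine_signature (machine_rules c (num x))) =
    (\<lambda>x. prod_encode (list_encode (map prod_encode machine_signature),
      Suc (prod_encode (prod_encode (enc_term (mSearch (Var 0) (Var 1)),
         enc_term (mEval c (tCons (Var 0) (tCons (Var 1) (tCons (num x) tNil))) (kSearch (Var 0) (Var 1)))),
      list_encode (map (\<lambda>(l, r). prod_encode (enc_term l, enc_term r)) fixed_rules)))))"
    by (simp add: enc_trs_def machine_rules_def)
  moreover have "total_computable (\<lambda>x.
      enc_term (mEval c (tCons (Var 0) (tCons (Var 1) (tCons (num x) tNil))) (kSearch (Var 0) (Var 1))))"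
    unfolding enc_term.simps list.map list_encode.simps
    by (intro computable_pair computable_Suc computable_const computable_enc_num)
  ultimately show ?thesis
    by (simp only:) (intro computable_pair computable_Suc computable_const)
qed

text \<open>The same map \<open>h\<close> works for both sets: for \<open>x\<close> in
  \<open>A\<close> the machine is confluent on every term, and otherwise it already fails on a
  ground term over its signature.\<close>

theorem Pi0_2_reducible:
  assumes "A \<in> Pi0 2"
  shows "many_one_reducible A (trs_property_codes confluent)"
    and "many_one_reducible A (trs_property_codes ground_confluent)"
proof -
  from assms obtain C where C: "decidable_set C"
    "\<And>x. x \<in> A \<longleftrightarrow> (\<forall>y. \<exists>z. prod_encode (prod_encode (x, y), z) \<in> C)"
    unfolding Pi0_2_iff by blast
  define P where "P x y z \<longleftrightarrow> prod_encode (prod_encode (x, y), z) \<in> C" for x y z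
  obtain rc where rc: "\<And>n. eval rc [n] (if n \<in> C then 1 else 0)"
    using C(1) unfolding decidable_set_def total_computable_def by blast
  obtain rp where rp: "\<And>a b. eval rp [a, b] (prod_encode (a, b))"
    using computable2_pair unfolding computable2_def by blast
  \<comment> \<open>The machine passes the arguments in the order \<open>z, y, x\<close>; the
    projections rearrange them into the nested pair tested by \<open>C\<close>.\<close>
  define r where "r = Comp rc [Comp rp [Comp rp [Proj 2, Proj 1], Proj 0]]"
  have r: "eval r [z, y, x] (if P x y z then 1 else 0)" for x y z
    unfolding r_def P_def
    by (rule eval_Comp1[OF eval_Comp2[OF eval_Comp2[OF eval_Proj' eval_Proj' rp] eval_Proj' rp] rc]) simp_all
  define h where "h x = enc_trs machine_signature (machine_rules (code r) (num x))" for x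
  have h: "total_computable h"
    unfolding h_def by (rule computable_machine)
  have trs: "is_trs (set machine_signature) (set (machine_rules (code r) (num x)))" for x
    by (rule is_trs_machine) (simp_all add: closed_data_code)
  have pos: "confluent_on (set (machine_rules (code r) (num x))) t" if "x \<in> A" for x t
    using machine_confluent[of r P x t] r that C(2) unfolding P_def by blast
  have neg: "\<exists>t. wf_term (set machine_signature) t \<and> ground t \<and>
      \<not> confluent_on (set (machine_rules (code r) (num x))) t" if "x \<notin> A" for x
  proof -
    obtain y where "\<forall>z. \<not> P x y z"
      using \<open>x \<notin> A\<close> C(2) unfolding P_def by blast
    then have "\<not> confluent_on (set (machine_rules (code r) (num x))) (mStart (num y))"
      using machine_not_confluent[of r P x y] r by blast
    moreover have "closed_data (num y)" by simp
    then have "wf_term (set machine_signature) (mStart (num y)) \<and> ground (mStart (num y))"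
      by (simp add: closed_data_def ground_def machine_signature_def del: closed_data_sucs)
    ultimately show ?thesis by blast
  qed
  have "x \<in> A \<longleftrightarrow> h x \<in> trs_property_codes confluent" for x
    unfolding h_def enc_trs_mem_codes_iff confluent_def using trs pos neg by blast
  then show "many_one_reducible A (trs_property_codes confluent)"
    unfolding many_one_reducible_def using h by blast
  have "x \<in> A \<longleftrightarrow> h x \<in> trs_property_codes ground_confluent" for x
    unfolding h_def enc_trs_mem_codes_iff ground_confluent_def using trs pos neg by blast
  then show "many_one_reducible A (trs_property_codes ground_confluent)"
    unfolding many_one_reducible_def using h by blast
qed

section \<open>Membership and completeness\<close>

definition derivation :: "nat \<Rightarrow> nat \<Rightarrow> nat \<Rightarrow> bool" where
  "derivation x p j \<longleftrightarrow> run judgement_schemas x p = Suc (prod_encode (j, 0))"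

lemma decidable_derivation:
  assumes "total_computable f" "total_computable p" "total_computable j"
  shows "total_computable (\<lambda>w. if derivation (f w) (p w) (j w) then 1 else 0)"
  unfolding derivation_def
  by (intro decidable_eq computable_run computable_Suc computable_pair computable_const assms)

lemma derives_iff_derivation: "derives x j \<longleftrightarrow> (\<exists>p. derivation x p j)"
  by (simp add: derivable_iff_run derivation_def)

text \<open>The mode \<open>m\<close> fixes the range of \<open>t\<close>: \<open>steps_mode\<close>
  for all well-formed terms, a suitable \<open>vars_mode\<close> for ground ones. Derivability is
  existential, so derivations of the premises join the universal quantifier and those of the
  conclusion the existential one.\<close>

lemma Pi0_2_joinability:
  "{x. derives x (jTrs (psnd x)) \<and> (\<forall>t t1 t2. derives x (jRel m t t) \<and> derives x (jRel steps_mode t t1) \<and>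
      derives x (jRel steps_mode t t2) \<longrightarrow>
      (\<exists>d. derives x (jRel steps_mode t1 d) \<and> derives x (jRel steps_mode t2 d)))} \<in> Pi0 2"
  (is "?A \<in> _")
proof -
  \<comment> \<open>\<open>y\<close> codes \<open>t, t1, t2\<close> and derivations of the three
    premises; \<open>z\<close> codes a derivation that the input is a rewrite system, the common
    reduct, and derivations of the two reductions to it.\<close>
  let ?y = "\<lambda>i w. entry i (psnd (pfst w))"
  let ?z = "\<lambda>i w. entry i (psnd w)"
  define C where "C = {w. derivation (pfst (pfst w)) (?z 0 w) (jTrs (psnd (pfst (pfst w)))) \<and>
    \<not> ((derivation (pfst (pfst w)) (?y 3 w) (jRel m (?y 0 w) (?y 0 w)) \<and>
        derivation (pfst (pfst w)) (?y 4 w) (jRel steps_mode (?y 0 w) (?y 1 w)) \<and>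
        derivation (pfst (pfst w)) (?y 5 w) (jRel steps_mode (?y 0 w) (?y 2 w))) \<and>
       \<not> (derivation (pfst (pfst w)) (?z 2 w) (jRel steps_mode (?y 1 w) (?z 1 w)) \<and>
          derivation (pfst (pfst w)) (?z 3 w) (jRel steps_mode (?y 2 w) (?z 1 w))))}"
  have "decidable_set C"
    unfolding decidable_set_def C_def mem_Collect_eq
    by (intro decidable_conj decidable_not decidable_derivation computable_pair computable_entry computable_pfst
        computable_psnd computable_const computable_id)
  moreover have "x \<in> ?A \<longleftrightarrow> (\<forall>y. \<exists>z. prod_encode (prod_encode (x, y), z) \<in> C)" for x
  proof
    assume A: "x \<in> ?A"
    show "\<forall>y. \<exists>z. prod_encode (prod_encode (x, y), z) \<in> C"
    proof
      fix y
      obtain p where p: "derivation x p (jTrs (psnd x))"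
        using A derives_iff_derivation by blast
      show "\<exists>z. prod_encode (prod_encode (x, y), z) \<in> C"
      proof (cases "derivation x (entry 3 y) (jRel m (entry 0 y) (entry 0 y)) \<and>
          derivation x (entry 4 y) (jRel steps_mode (entry 0 y) (entry 1 y)) \<and>
          derivation x (entry 5 y) (jRel steps_mode (entry 0 y) (entry 2 y))")
        case True
        then obtain d where "derives x (jRel steps_mode (entry 1 y) d)" "derives x (jRel steps_mode (entry 2 y) d)"
          using A derives_iff_derivation by blast
        then obtain q1 q2 where "derivation x q1 (jRel steps_mode (entry 1 y) d)"
          "derivation x q2 (jRel steps_mode (entry 2 y) d)"
          unfolding derives_iff_derivation by blast
        with p have "prod_encode (prod_encode (x, y), tuple [p, d, q1, q2]) \<in> C"
          by (simp add: C_def numeral_eq_Suc)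
        then show ?thesis ..
      next
        case False
        with p have "prod_encode (prod_encode (x, y), tuple [p]) \<in> C"
          by (auto simp: C_def)
        then show ?thesis ..
      qed
    qed
  next
    assume C: "\<forall>y. \<exists>z. prod_encode (prod_encode (x, y), z) \<in> C"
    show "x \<in> ?A"
      unfolding mem_Collect_eq
    proof (intro conjI allI impI)
      from C obtain z where "prod_encode (prod_encode (x, 0), z) \<in> C" by blast
      then show "derives x (jTrs (psnd x))"
        unfolding derives_iff_derivation C_def by auto
    next
      fix t t1 t2
      assume "derives x (jRel m t t) \<and> derives x (jRel steps_mode t t1) \<and> derives x (jRel steps_mode t t2)"
      then obtain p p1 p2 where p: "derivation x p (jRel m t t)" "derivation x p1 (jRel steps_mode t t1)"
        "derivation x p2 (jRel steps_mode t t2)"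
        unfolding derives_iff_derivation by blast
      from C obtain z where "prod_encode (prod_encode (x, tuple [t, t1, t2, p, p1, p2]), z) \<in> C" by blast
      with p have "derivation x (entry 2 z) (jRel steps_mode t1 (entry 1 z)) \<and>
          derivation x (entry 3 z) (jRel steps_mode t2 (entry 1 z))"
        by (simp add: C_def numeral_eq_Suc)
      then show "\<exists>d. derives x (jRel steps_mode t1 d) \<and> derives x (jRel steps_mode t2 d)"
        unfolding derives_iff_derivation by blast
    qed
  qed
  ultimately show ?thesis
    unfolding Pi0_2_iff by blast
qed

lemma derives_steps_iff:
  assumes "is_trs (sig_of x) (rules_of x)"
  shows "derives x (jRel steps_mode s t) \<longleftrightarrow> steps_sem x s t"
proof
  show "derives x (jRel steps_mode s t) \<Longrightarrow> steps_sem x s t"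
    using derives_sound by fastforce
  show "steps_sem x s t \<Longrightarrow> derives x (jRel steps_mode s t)"
    unfolding steps_sem_def using derives_rsteps[OF assms] by blast
qed

lemma derives_join_iff:
  assumes trs: "is_trs (sig_of x) (rules_of x)" and wf: "wf_term (sig_of x) t"
  shows "(\<forall>t1 t2. derives x (jRel steps_mode (enc_term t) t1) \<and> derives x (jRel steps_mode (enc_term t) t2) \<longrightarrow>
      (\<exists>d. derives x (jRel steps_mode t1 d) \<and> derives x (jRel steps_mode t2 d))) \<longleftrightarrow>
    confluent_on (rules_of x) t"
  (is "?L \<longleftrightarrow> _")
proof
  assume L: ?L
  show "confluent_on (rules_of x) t"
    unfolding confluent_on_def
  proof (intro allI impI)
    fix t1 t2 assume "rsteps (rules_of x) t t1 \<and> rsteps (rules_of x) t t2"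
    then have "derives x (jRel steps_mode (enc_term t) (enc_term t1))"
      "derives x (jRel steps_mode (enc_term t) (enc_term t2))"
      using derives_rsteps[OF trs _ wf] by blast+
    with L obtain d where "derives x (jRel steps_mode (enc_term t1) d)" "derives x (jRel steps_mode (enc_term t2) d)"
      by blast
    then show "\<exists>d. rsteps (rules_of x) t1 d \<and> rsteps (rules_of x) t2 d"
      unfolding derives_steps_iff[OF trs] steps_sem_def by (metis enc_term_inject)
  qed
next
  assume conf: "confluent_on (rules_of x) t"
  show ?L
  proof (intro allI impI)
    fix c1 c2 assume "derives x (jRel steps_mode (enc_term t) c1) \<and> derives x (jRel steps_mode (enc_term t) c2)"
    then obtain t1 t2 where t: "c1 = enc_term t1" "c2 = enc_term t2" "rsteps (rules_of x) t t1"
      "rsteps (rules_of x) t t2" "wf_term (sig_of x) t1" "wf_term (sig_of x) t2"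
      unfolding derives_steps_iff[OF trs] steps_sem_def by auto
    then obtain d where "rsteps (rules_of x) t1 d" "rsteps (rules_of x) t2 d"
      using conf unfolding confluent_on_def by blast
    then have "derives x (jRel steps_mode c1 (enc_term d)) \<and> derives x (jRel steps_mode c2 (enc_term d))"
      using derives_rsteps[OF trs] t by blast
    then show "\<exists>d. derives x (jRel steps_mode c1 d) \<and> derives x (jRel steps_mode c2 d)" ..
  qed
qed

text \<open>The constant \<open>Fun 0 []\<close> merely stands for the empty set of variables:
  \<open>vars_mode\<close> collects variables of its parameter and does not ask whether the
  parameter fits the signature.\<close>

lemma derives_ground_iff:
  "derives x (jRel (vars_mode (enc_term (Fun 0 []))) c c) \<longleftrightarrow>
    (\<exists>t. c = enc_term t \<and> wf_term (sig_of x) t \<and> ground t)"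
proof
  assume "derives x (jRel (vars_mode (enc_term (Fun 0 []))) c c)"
  then have "vars_sem x (enc_term (Fun 0 [])) c c"
    using derives_sound by fastforce
  then obtain s where s: "c = enc_term s" "wf_term (sig_of x) s"
    "\<And>l. enc_term (Fun 0 []) = enc_term l \<Longrightarrow> vars s \<subseteq> vars l"
    unfolding vars_sem_def by blast
  with s(3)[OF refl] show "\<exists>t. c = enc_term t \<and> wf_term (sig_of x) t \<and> ground t"
    by (auto simp: ground_def)
next
  assume "\<exists>t. c = enc_term t \<and> wf_term (sig_of x) t \<and> ground t"
  then show "derives x (jRel (vars_mode (enc_term (Fun 0 []))) c c)"
    using derives_vars[of x _ "Fun 0 []"] unfolding ground_def by auto
qed

lemma Pi0_2_trs_property:
  assumes P: "\<And>\<Sigma> R. P \<Sigma> R \<longleftrightarrow> (\<forall>t. wf_term \<Sigma> t \<and> Q t \<longrightarrow> confluent_on R t)"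
    and m: "\<And>x c. is_trs (sig_of x) (rules_of x) \<Longrightarrow>
      derives x (jRel m c c) \<longleftrightarrow> (\<exists>t. c = enc_term t \<and> wf_term (sig_of x) t \<and> Q t)"
  shows "trs_property_codes P \<in> Pi0 2"
proof -
  let ?J = "\<lambda>x. \<forall>t t1 t2. derives x (jRel m t t) \<and> derives x (jRel steps_mode t t1) \<and>
      derives x (jRel steps_mode t t2) \<longrightarrow>
      (\<exists>d. derives x (jRel steps_mode t1 d) \<and> derives x (jRel steps_mode t2 d))"
  have J: "?J x \<longleftrightarrow> P (set sig) (set rs)" if x: "x = enc_trs sig rs" "is_trs (set sig) (set rs)" for x sig rs
  proof -
    have trs: "is_trs (sig_of x) (rules_of x)" and sr: "sig_of x = set sig" "rules_of x = set rs"
      using x by simp_all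
    have "?J x \<longleftrightarrow> (\<forall>t. wf_term (sig_of x) t \<and> Q t \<longrightarrow> (\<forall>t1 t2. derives x (jRel steps_mode (enc_term t) t1) \<and>
        derives x (jRel steps_mode (enc_term t) t2) \<longrightarrow>
        (\<exists>d. derives x (jRel steps_mode t1 d) \<and> derives x (jRel steps_mode t2 d))))"
      unfolding m[OF trs] by blast
    also have "\<dots> \<longleftrightarrow> (\<forall>t. wf_term (sig_of x) t \<and> Q t \<longrightarrow> confluent_on (rules_of x) t)"
      using derives_join_iff[OF trs] by blast
    finally show ?thesis
      unfolding P sr .
  qed
  have "trs_property_codes P = {x. derives x (jTrs (psnd x)) \<and> ?J x}"
    unfolding derives_Trs_iff trs_property_codes_def using J by blast
  then show ?thesis
    using Pi0_2_joinability[of m] by simp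
qed

lemma confluent_Pi0_2: "trs_property_codes confluent \<in> Pi0 2"
proof (rule Pi0_2_trs_property)
  show "confluent \<Sigma> R \<longleftrightarrow> (\<forall>t. wf_term \<Sigma> t \<and> True \<longrightarrow> confluent_on R t)" for \<Sigma> R
    by (simp add: confluent_def)
  \<comment> \<open>Reflexivity doubles as the test for being the code of a well-formed term, since
    \<open>steps_mode\<close> demands well-formedness of both sides.\<close>
  show "derives x (jRel steps_mode c c) \<longleftrightarrow> (\<exists>t. c = enc_term t \<and> wf_term (sig_of x) t \<and> True)"
    if "is_trs (sig_of x) (rules_of x)" for x c
    unfolding derives_steps_iff[OF that] steps_sem_def by (metis rsteps_refl)
qed

lemma ground_confluent_Pi0_2: "trs_property_codes ground_confluent \<in> Pi0 2"
  by (rule Pi0_2_trs_property[OF ground_confluent_def derives_ground_iff])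

theorem theorem3:
  shows "complete_for (Pi0 2) (trs_property_codes confluent)
       \<and> complete_for (Pi0 2) (trs_property_codes ground_confluent)"
  unfolding complete_for_def
  using confluent_Pi0_2 ground_confluent_Pi0_2 Pi0_2_reducible by blast

end
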